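(* Let $r\ge 1$, let $q=p^k$ with $p$ prime, and let $G=\mathrm{SL}_3(\mathbb{F}_q)$. Say that $q$ is in case (A) if $p\equiv 1 \bmod 3$, or $p\equiv -1\bmod 3$ and $k$ is even; say that $q$ is in case (B) if $p\equiv 0\bmod 3$, or $p\equiv -1\bmod 3$ and $k$ is odd. The number of closed conjugation orbits (orbits under simultaneous conjugation by $G$) in each stratum of $\mathrm{SL}_3(\mathbb{F}_q)^r$ is as follows. 1. Central stratum: $3^r$ in case (A), and $1$ in case (B). 2. Repeating stratum: $(q-1)^r-3^r$ in case (A), and $(q-1)^r-1$ in case (B). 3. Reducible stratum: $\frac{(q-1)^{2r}}{6}-\frac{(q-1)^r}{2}+3^{r-1}$ in case (A), and $\frac{(q-1)^{2r}}{6}-\frac{(q-1)^r}{2}+\frac13$ in case (B). 4. Irreducible stratum: $\frac{(q^2+q+1)^r}{3}-3^{r-1}$ in case (A), and $\frac{(q^2+q+1)^r}{3}-\frac13$ in case (B). 5. Partially reducible stratum: $\frac{(q^2-1)^r}{2}-\frac{(q-1)^r}{2}$ in both cases (A) and (B).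
   Context: $\overline{\mathbb{F}}_q$ is the algebraic closure of $\mathbb{F}_q$. The group $G=\mathrm{SL}_3(\mathbb{F}_q)$ acts on $\mathrm{SL}_3(\mathbb{F}_q)^r$ by simultaneous conjugation. The tuples with closed orbit are those which are simultaneously diagonalizable over $\overline{\mathbb{F}}_q$. A tuple $(D_1,\dots,D_r)$ of diagonal matrices in $\mathrm{SL}_3(\overline{\mathbb{F}}_q)$ is called: - central if every $D_i$ is a scalar matrix with entry in $\mathbb{F}_q$; - repeating if all diagonal entries of all $D_i$ lie in $\mathbb{F}_q$, the $D_i$ are not all scalar, and there are two positions $s\neq t$ in $\{1,2,3\}$ such that, for every $i$, the $s$-th and $t$-th diagonal entries of $D_i$ are equal; - reducible if all diagonal entries of all $D_i$ lie in $\mathbb{F}_q$ and the tuple is neither central nor repeating (equivalently, some $D_i$ has three distinct diagonal entries, or two of the $D_i$ have exactly two equal diagonal entries but in different pairs of positions); - irreducible if there is an $i$ such that all diagonal entries of $D_i$ lie in $\overline{\mathbb{F}}_q\setminus\mathbb{F}_q$; - partially reducible if there is an $i$ such that exactly two diagonal entries of $D_i$ lie in $\overline{\mathbb{F}}_q\setminus\mathbb{F}_q$. For X one of these five types, a tuple $(A_1,\dots,A_r)\in\mathrm{SL}_3(\mathbb{F}_q)^r$ is in the X stratum if there is $P\in\mathrm{GL}_3(\overline{\mathbb{F}}_q)$ such that $(PA_1P^{-1},\dots,PA_rP^{-1})$ is an X tuple. *)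

theory Defs
  imports
    "HOL-Analysis.Analysis"
    "HOL-Algebra.Group_Action"
    "HOL-Algebra.Algebraic_Closure_Type"
    "HOL-Number_Theory.Cong"
begin

text \<open>
  The field with \<open>q\<close> elements is a type \<open>'a :: {field, finite}\<close> with \<open>CARD('a) = q\<close>,
  its algebraic closure is \<open>'a alg_closure\<close> with embedding \<^const>\<open>to_ac\<close>, and an
  \<open>r\<close>-tuple of matrices is a list of length \<open>r\<close>.
\<close>

definition SL3 :: "('a::comm_ring_1 ^ 3 ^ 3) monoid" where
  "SL3 = \<lparr>carrier = {A. det A = 1}, monoid.mult = (\<lambda>A B. A ** B), one = mat 1\<rparr>"

definition SL3_tuples :: "nat \<Rightarrow> ('a::comm_ring_1 ^ 3 ^ 3) list set" where
  "SL3_tuples r = {As. length As = r \<and> set As \<subseteq> carrier SL3}"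

definition conj_tuple ::
    "'a::comm_ring_1 ^ 3 ^ 3 \<Rightarrow> ('a ^ 3 ^ 3) list \<Rightarrow> ('a ^ 3 ^ 3) list" where
  "conj_tuple P As = map (\<lambda>A. P ** A ** matrix_inv P) As"

text \<open>The restriction makes this a \<^locale>\<open>group_action\<close> of \<^const>\<open>SL3\<close> on
  \<open>SL3_tuples r\<close>, whose members have to be extensional functions.\<close>

definition conj_action ::
    "nat \<Rightarrow> 'a::comm_ring_1 ^ 3 ^ 3 \<Rightarrow> ('a ^ 3 ^ 3) list \<Rightarrow> ('a ^ 3 ^ 3) list" where
  "conj_action r g = (\<lambda>As \<in> SL3_tuples r. conj_tuple g As)"

abbreviation (input) base_field :: "'a::field alg_closure set" where
  "base_field \<equiv> range to_ac"

definition diagonal_matrix :: "'b::zero ^ 3 ^ 3 \<Rightarrow> bool" where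
  "diagonal_matrix D \<longleftrightarrow> (\<forall>i j. i \<noteq> j \<longrightarrow> D $ i $ j = 0)"

definition scalar_matrix :: "'b::zero ^ 3 ^ 3 \<Rightarrow> bool" where
  "scalar_matrix D \<longleftrightarrow> diagonal_matrix D \<and> (\<forall>i j. D $ i $ i = D $ j $ j)"

definition diagonal_tuple :: "('b::comm_ring_1 ^ 3 ^ 3) list \<Rightarrow> bool" where
  "diagonal_tuple Ds \<longleftrightarrow> (\<forall>D \<in> set Ds. diagonal_matrix D \<and> D \<in> carrier SL3)"

definition central_tuple :: "('a::field alg_closure ^ 3 ^ 3) list \<Rightarrow> bool" where
  "central_tuple Ds \<longleftrightarrow> diagonal_tuple Ds \<and>
     (\<forall>D \<in> set Ds. scalar_matrix D \<and> (\<forall>i. D $ i $ i \<in> base_field))"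

definition repeating_tuple :: "('a::field alg_closure ^ 3 ^ 3) list \<Rightarrow> bool" where
  "repeating_tuple Ds \<longleftrightarrow> diagonal_tuple Ds \<and>
     (\<forall>D \<in> set Ds. \<forall>i. D $ i $ i \<in> base_field) \<and>
     \<not> (\<forall>D \<in> set Ds. scalar_matrix D) \<and>
     (\<exists>s t. s \<noteq> t \<and> (\<forall>D \<in> set Ds. D $ s $ s = D $ t $ t))"

definition reducible_tuple :: "('a::field alg_closure ^ 3 ^ 3) list \<Rightarrow> bool" where
  "reducible_tuple Ds \<longleftrightarrow> diagonal_tuple Ds \<and>
     (\<forall>D \<in> set Ds. \<forall>i. D $ i $ i \<in> base_field) \<and>
     \<not> central_tuple Ds \<and> \<not> repeating_tuple Ds"

definition irreducible_tuple :: "('a::field alg_closure ^ 3 ^ 3) list \<Rightarrow> bool" where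
  "irreducible_tuple Ds \<longleftrightarrow> diagonal_tuple Ds \<and>
     (\<exists>D \<in> set Ds. \<forall>i. D $ i $ i \<notin> base_field)"

definition partially_reducible_tuple :: "('a::field alg_closure ^ 3 ^ 3) list \<Rightarrow> bool" where
  "partially_reducible_tuple Ds \<longleftrightarrow> diagonal_tuple Ds \<and>
     (\<exists>D \<in> set Ds. card {i. D $ i $ i \<notin> base_field} = 2)"

definition stratum ::
    "(('a::field alg_closure ^ 3 ^ 3) list \<Rightarrow> bool) \<Rightarrow> nat \<Rightarrow> ('a ^ 3 ^ 3) list set" where
  "stratum S r = {As \<in> SL3_tuples r.
     \<exists>P. invertible P \<and> S (conj_tuple P (map (map_matrix to_ac) As))}"

text \<open>An orbit is closed if the tuples in it are simultaneously diagonalizable over the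
  algebraic closure; this is the convention taken as definition here.\<close>

definition closed_tuples :: "nat \<Rightarrow> ('a::field ^ 3 ^ 3) list set" where
  "closed_tuples r = {As \<in> SL3_tuples r. \<exists>P. invertible P \<and>
     (\<forall>D \<in> set (conj_tuple P (map (map_matrix to_ac) As)). diagonal_matrix D)}"

definition closed_orbits :: "nat \<Rightarrow> ('a::field ^ 3 ^ 3) list set set" where
  "closed_orbits r = orbits SL3 (closed_tuples r) (conj_action r)"

definition num_closed_orbits ::
    "nat \<Rightarrow> (('a::field alg_closure ^ 3 ^ 3) list \<Rightarrow> bool) \<Rightarrow> nat" where
  "num_closed_orbits r S = card {Orb \<in> closed_orbits r. Orb \<subseteq> stratum S r}"

definition case_A :: "nat \<Rightarrow> nat \<Rightarrow> bool" where
  "case_A p k \<longleftrightarrow> [int p = 1] (mod 3) \<or> ([int p = -1] (mod 3) \<and> even k)"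

definition case_B :: "nat \<Rightarrow> nat \<Rightarrow> bool" where
  "case_B p k \<longleftrightarrow> [int p = 0] (mod 3) \<or> ([int p = -1] (mod 3) \<and> odd k)"

end

(* Over K, the algebraic closure of F_q, a closed tuple is P^-1 diag(d_i) P, and its three characters
   (the diagonal positions) are determined up to a permutation. Since the tuple is fixed by
   Frobenius, Frobenius permutes the characters by some s in S_3. Up to conjugation s is the identity,
   the transposition (1 2) or the 3-cycle, so the d_i lie in the rational points of one of the
   three tori of SL_3, of orders (q-1)^2, q^2-1 and q^2+q+1. Conversely every tuple in such a torus
   arises, and two tuples with the same characters are conjugate under SL_3(F_q): P can be
   chosen with Frob(P) equal to P with rows permuted by s (Lang's theorem for the torus), and then the
   quotient of two such P is rational, while its determinant is adjusted by the surjective norm.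
   So the orbits of a stratum are classes of tuples of torus elements modulo the centralizer of
   s in S_3. *)

theory Submission
  imports Defs "HOL-Number_Theory.Residues"
begin

text \<open>Lang's theorem for a torus corrects a diagonalizer only by a diagonal factor, so it
  needs the three characters to be pairwise distinct. Such tuples, called \<open>separating\<close>,
  account for the reducible, irreducible and partially reducible strata, with s the identity, the
  3-cycle and the transposition. Permutations act freely on them, so a class has as many members as
  the centralizer of s: 6, 3 and 2, the denominators in the formulas. In the central and repeating
  strata characters coincide, s is not unique and diagonalizers differ by more than a torus; there a
  rational eigenbasis is built by hand, and each class has a single normal form. To count separating
  tuples, one removes from the r-th power of a torus the tuples on which two characters agree. What
  is removed comes from the centre, with c elements, and from subtori with q-1 elements, leaving
  (q-1)^(2r) - 3(q-1)^r + 2c^r, (q^2+q+1)^r - c^r and (q^2-1)^r - (q-1)^r. Here c is the number of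
  cube roots of unity in F_q, 3 in case (A) and 1 in case (B); the two cases matter nowhere
  else.\<close>

no_notation fps_nth (infixl \<open>$\<close> 75)

section \<open>Finite fields, roots of unity and the Frobenius map\<close>

lemma finite_field_power_card:
  fixes x :: "'a::{field,finite}"
  shows "x ^ CARD('a) = x"
proof (cases "x = 0")
  case False
  let ?U = "UNIV - {0::'a}"
  have "bij_betw ((*) x) ?U ?U"
    using False by (intro bij_betw_byWitness[where f' = "\<lambda>y. y / x"]) auto
  \<comment> \<open>Multiplication by \<open>x\<close> permutes the nonzero elements; cancelling
    their product leaves a power of \<open>x\<close> equal to 1.\<close>
  then have "(\<Prod>y\<in>?U. x * y) = \<Prod>?U"
    by (rule prod.reindex_bij_betw[where g = "\<lambda>y. y"])
  then have "x ^ card ?U = 1"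
    by (simp add: prod.distrib)
  moreover have "CARD('a) = Suc (card ?U)"
    by (rule card.remove) auto
  ultimately show ?thesis
    by (simp only: power_Suc mult.right_neutral)
qed (simp add: power_0_left)

text \<open>X^n - 1 has no multiple root: one would also be a root of the derivative n X^(n-1),
  hence 0, which is not a root. So the n linear factors are distinct.\<close>

lemma card_roots_of_unity_alg_closed:
  assumes "of_nat n \<noteq> (0 :: 'a::alg_closed_field)"
  shows "card {x :: 'a. x ^ n = 1} = n"
proof -
  have n: "n > 0"
    using assms by (cases n) auto
  define f :: "'a poly" where "f = Polynomial.monom 1 n - 1"
  have deg: "Polynomial.degree f = n"
    unfolding f_def using n
    by (subst diff_conv_add_uminus, subst degree_add_eq_left) (simp_all add: degree_monom_eq)
  then have f0: "f \<noteq> 0" "Polynomial.lead_coeff f = 1"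
    using n by (auto simp: f_def)
  have root: "poly f x = 0 \<longleftrightarrow> x ^ n = 1" for x
    by (simp add: f_def poly_monom)
  obtain A where A: "size A = n" "f = (\<Prod>x\<in>#A. [:-x, 1:])"
    using alg_closed_imp_factorization[OF f0(1)] f0(2) deg by auto
  have count_le: "count A x \<le> 1" for x
  proof (rule ccontr)
    assume "\<not> count A x \<le> 1"
    then have "{#x, x#} \<subseteq># A"
      by (simp add: subseteq_mset_def)
    then have "[:-x, 1:] ^ 2 dvd f"
      unfolding A(2)
      using prod_mset_subset_imp_dvd[OF image_mset_subseteq_mono, of "{#x, x#}" A "\<lambda>x. [:-x, 1:]"]
      by (simp only: image_mset_add_mset image_mset_empty prod_mset.add_mset prod_mset_empty
          power2_eq_square mult.right_neutral)
    then obtain g where g: "f = [:-x, 1:] ^ 2 * g"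
      by (elim dvdE)
    have "poly (pderiv f) x = 0" and fx: "poly f x = 0"
      by (simp_all add: g pderiv_mult pderiv_power)
    then have "of_nat n * x ^ (n - 1) = 0"
      by (simp add: f_def pderiv_diff pderiv_monom poly_monom)
    with assms have "x = 0"
      by simp
    with fx n show False
      by (simp add: root power_0_left)
  qed
  then have card_A: "card (set_mset A) = n"
  proof -
    have "count A x = 1" if "x \<in># A" for x
      using count_le[of x] that by (simp add: le_antisym Suc_leI)
    then have "size A = (\<Sum>x\<in>set_mset A. 1)"
      unfolding size_multiset_overloaded_eq by (intro sum.cong) auto
    with A(1) show ?thesis
      by simp
  qed
  have "set_mset A = {x. x ^ n = 1}"
    by (simp add: set_eq_iff A(2) poly_prod_mset prod_mset_zero_iff image_iff flip: root)
  with card_A show ?thesis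
    by (simp only:)
qed

locale finite_field_closure =
  fixes F :: "'a::{field,finite} itself" and p k q :: nat
  assumes prime_p: "Factorial_Ring.prime p" and q_def: "q = p ^ k" and card_F: "CARD('a) = q"
begin

definition frob :: "'a alg_closure \<Rightarrow> 'a alg_closure" where
  "frob x = x ^ q"

lemma q_gt_1: "q > 1"
proof -
  have "card {0, 1 :: 'a} \<le> CARD('a)"
    by (rule card_mono) auto
  then show ?thesis
    by (simp add: card_F)
qed

lemma CHAR_F: "CHAR('a) = p"
proof -
  have "Factorial_Ring.prime CHAR('a)"
    by (simp add: finite_imp_CHAR_pos prime_CHAR_semidom)
  moreover have "CHAR('a) dvd p ^ k"
    using CHAR_dvd_CARD[where 'a = 'a] card_F q_def by simp
  ultimately show ?thesis
    using prime_p by (meson prime_dvd_power primes_dvd_imp_eq)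
qed

lemma of_nat_q: "of_nat q = (0 :: 'a alg_closure)"
proof -
  have "k \<noteq> 0"
    using q_gt_1 q_def by (cases k) auto
  then have "p dvd q"
    by (simp add: q_def)
  then show ?thesis
    by (simp add: of_nat_eq_0_iff_char_dvd CHAR_F)
qed

lemma frob_0 [simp]: "frob 0 = 0" and frob_1 [simp]: "frob 1 = 1"
  using q_gt_1 by (auto simp: frob_def)

lemma frob_mult: "frob (x * y) = frob x * frob y"
  by (simp add: frob_def power_mult_distrib)

lemma frob_inverse: "frob (inverse x) = inverse (frob x)"
  by (simp add: frob_def power_inverse)

lemma frob_divide: "frob (x / y) = frob x / frob y"
  by (simp add: frob_def power_divide)

lemma frob_power: "frob (x ^ n) = frob x ^ n"
  by (simp add: frob_def power_commutes flip: power_mult) (simp add: mult.commute)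

lemma frob_add: "frob (x + y) = frob x + frob y"
  unfolding frob_def
  by (rule freshmans_dream'[where n = k]) (use prime_p q_def in \<open>simp_all add: CHAR_F\<close>)

lemma frob_minus: "frob (- x) = - frob x"
  using frob_add[of x "- x"] by (simp add: eq_neg_iff_add_eq_0 add.commute)

lemma frob_diff: "frob (x - y) = frob x - frob y"
  using frob_add[of x "- y"] by (simp add: frob_minus)

lemma frob_eq_0_iff [simp]: "frob x = 0 \<longleftrightarrow> x = 0"
  using q_gt_1 by (simp add: frob_def)

lemma frob_eq_iff [simp]: "frob x = frob y \<longleftrightarrow> x = y"
  using frob_eq_0_iff[of "x - y"] by (simp add: frob_diff)

lemmas frob_simps = frob_mult frob_inverse frob_divide frob_power frob_add frob_minus frob_diff

lemma frob_sum: "frob (sum f A) = (\<Sum>x\<in>A. frob (f x))"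
  by (induction A rule: infinite_finite_induct) (simp_all add: frob_add)

lemma frob_to_ac [simp]: "frob (to_ac x) = to_ac x"
  unfolding frob_def using finite_field_power_card[of x] card_F by (simp flip: to_ac_power)

text \<open>Fixed points of Frobenius are roots of X^q - X, so there are at most \<open>q\<close> of
  them, and the embedded field already supplies \<open>q\<close>.\<close>

lemma base_field_iff: "x \<in> base_field \<longleftrightarrow> frob x = x"
proof -
  define f :: "'a alg_closure poly" where "f = Polynomial.monom 1 q - [:0, 1:]"
  have deg: "Polynomial.degree f = q"
    unfolding f_def using q_gt_1
    by (subst diff_conv_add_uminus, subst degree_add_eq_left) (simp_all add: degree_monom_eq)
  then have "f \<noteq> 0"
    using q_gt_1 by auto
  have fix_eq: "{x. frob x = x} = {x. poly f x = 0}"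
    by (simp add: f_def poly_monom frob_def)
  have "base_field = {x :: 'a alg_closure. frob x = x}"
  proof (rule card_subset_eq)
    show fin: "finite {x :: 'a alg_closure. frob x = x}"
      unfolding fix_eq using \<open>f \<noteq> 0\<close> by (rule poly_roots_finite)
    show sub: "base_field \<subseteq> {x :: 'a alg_closure. frob x = x}"
      by auto
    have "card {x :: 'a alg_closure. frob x = x} \<le> q"
      unfolding fix_eq using card_poly_roots_bound[OF \<open>f \<noteq> 0\<close>] deg by simp
    moreover have "card (base_field :: 'a alg_closure set) = q"
      using card_F by (simp add: card_image inj_to_ac)
    ultimately show "card (base_field :: 'a alg_closure set) = card {x :: 'a alg_closure. frob x = x}"
      using card_mono[OF fin sub] by simp
  qed
  then show ?thesis
    by blast
qed

text \<open>Since \<open>p\<close> divides \<open>q\<close>, such an \<open>m\<close> is prime to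
  the characteristic. This covers q-1, q^2-1 and q^2+q+1, the exponents whose roots of unity are
  counted later.\<close>

lemma of_nat_neq_0_mod_q:
  assumes "[int m = 1] (mod int q) \<or> [int m = -1] (mod int q)"
  shows "of_nat m \<noteq> (0 :: 'a alg_closure)"
proof
  assume "of_nat m = (0 :: 'a alg_closure)"
  then have "p dvd m"
    by (simp add: of_nat_eq_0_iff_char_dvd CHAR_F)
  then have "int p dvd int m"
    by simp
  moreover have "int p dvd int q"
    using of_nat_q by (simp add: of_nat_eq_0_iff_char_dvd CHAR_F)
  ultimately have "int p dvd 1"
    using assms
    by (metis cong_dvd_iff cong_dvd_modulus dvd_minus_iff)
  then show False
    using prime_p by (simp add: prime_nat_iff)
qed

end

section \<open>Simultaneous diagonalization over a field\<close>

lemma matrix_inv_right: "invertible P \<Longrightarrow> P ** matrix_inv P = mat 1"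
  and matrix_inv_left: "invertible P \<Longrightarrow> matrix_inv P ** P = mat 1"
  unfolding invertible_def matrix_inv_def by (metis (mono_tags, lifting) someI_ex)+

lemma matrix_mul_right_cancel:
  assumes "invertible P"
  shows "A ** P = B ** P \<longleftrightarrow> A = B"
  by (metis assms matrix_inv_right matrix_mul_assoc matrix_mul_rid)

lemma matrix_mul_left_cancel:
  assumes "invertible P"
  shows "P ** A = P ** B \<longleftrightarrow> A = B"
  by (metis assms matrix_inv_left matrix_mul_assoc matrix_mul_lid)

lemma invertible_matrix_inv: "invertible P \<Longrightarrow> invertible (matrix_inv P)"
  unfolding invertible_def[of "matrix_inv P"] using matrix_inv_left matrix_inv_right by blast

lemma invertible_conj_eq_iff:
  assumes "invertible P"
  shows "P ** A ** matrix_inv P = D \<longleftrightarrow> P ** A = D ** P"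
  by (metis assms matrix_inv_left matrix_inv_right matrix_mul_assoc matrix_mul_rid)

definition diagm :: "'b::zero ^ 'n \<Rightarrow> 'b ^ 'n ^ 'n" where
  "diagm d = (\<chi> i j. if i = j then d $ i else 0)"

lemma diagm_diag [simp]: "diagm d $ i $ i = d $ i"
  by (simp add: diagm_def)

lemma diagm_off_diag [simp]: "i \<noteq> j \<Longrightarrow> diagm d $ i $ j = 0"
  by (simp add: diagm_def)

lemma diagm_mult_nth: "(diagm d ** M) $ i $ j = d $ i * M $ i $ j"
  by (simp add: matrix_matrix_mult_def diagm_def if_distrib[of "\<lambda>x. x * _"] cong: if_cong)

lemma mult_diagm_nth: "(M ** diagm d) $ i $ j = M $ i $ j * d $ j"
  by (simp add: matrix_matrix_mult_def diagm_def if_distrib[of "\<lambda>x. _ * x"] cong: if_cong)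

lemma diagm_commute: "diagm c ** diagm d = diagm d ** (diagm c :: 'b::comm_semiring_1 ^ 'n ^ 'n)"
  unfolding vec_eq_iff
proof (intro allI)
  show "(diagm c ** diagm d) $ i $ j = (diagm d ** diagm c) $ i $ j" for i j
    unfolding diagm_mult_nth using mult.commute[of "c $ j" "d $ j"] by (cases "i = j") simp_all
qed

lemma det_diagm: "det (diagm d) = (\<Prod>i\<in>UNIV. d $ i)"
  by (subst det_diagonal) (simp_all add: diagm_def)

lemma det_diagm_3: "det (diagm d :: 'b::comm_ring_1 ^ 3 ^ 3) = d $ 1 * d $ 2 * d $ 3"
  by (simp add: det_3)

lemma diagonal_matrix_diagm [simp]: "diagonal_matrix (diagm d)"
  by (simp add: diagonal_matrix_def diagm_def)

definition vperm :: "('n \<Rightarrow> 'n) \<Rightarrow> 'b ^ 'n \<Rightarrow> 'b ^ 'n" where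
  "vperm \<pi> d = (\<chi> i. d $ \<pi> i)"

lemma vperm_nth [simp]: "vperm \<pi> d $ i = d $ \<pi> i"
  by (simp add: vperm_def)

text \<open>The inverse-free form says that row i of \<open>P\<close> is a left eigenvector of every
  matrix, with the i-th character as eigenvalue. Permuting characters is thus permuting
  rows.\<close>

definition diagonalizes ::
    "'b::field ^ 'n ^ 'n \<Rightarrow> ('b ^ 'n ^ 'n) list \<Rightarrow> ('b ^ 'n) list \<Rightarrow> bool" where
  "diagonalizes P As ds \<longleftrightarrow>
     invertible P \<and> list_all2 (\<lambda>A d. P ** A = diagm d ** P) As ds"

lemma diagonalizes_iff_conj_tuple:
  "diagonalizes P As ds \<longleftrightarrow> invertible P \<and> conj_tuple P As = map diagm ds"
proof -
  have "conj_tuple P As = map diagm ds \<longleftrightarrow>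
      list_all2 (\<lambda>A d. P ** A ** matrix_inv P = diagm d) As ds"
    by (auto simp: conj_tuple_def list_all2_conv_all_nth list_eq_iff_nth_eq)
  then show ?thesis
    by (auto simp: diagonalizes_def invertible_conj_eq_iff)
qed

lemma diagonalizes_vperm:
  assumes "diagonalizes P As ds" and "\<pi> permutes UNIV"
  shows "diagonalizes (\<chi> i. P $ \<pi> i) As (map (vperm \<pi>) ds)"
proof -
  have "invertible (\<chi> i. P $ \<pi> i)"
    using assms by (simp add: diagonalizes_def invertible_det_nz det_permute_rows sign_def)
  moreover have "(\<chi> i. P $ \<pi> i) ** A = diagm (vperm \<pi> d) ** (\<chi> i. P $ \<pi> i)"
    if "P ** A = diagm d ** P" for A d
  proof -
    have "((\<chi> i. P $ \<pi> i) ** A) $ i $ j = (P ** A) $ \<pi> i $ j" for i j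
      by (simp add: matrix_matrix_mult_def)
    with that show ?thesis
      by (simp add: vec_eq_iff diagm_mult_nth)
  qed
  ultimately show ?thesis
    using assms(1) by (auto simp: diagonalizes_def list_all2_conv_all_nth)
qed

text \<open>The change of basis \<open>R\<close> between the two diagonalizers is invertible, so
  some term of the Leibniz expansion of its determinant is nonzero. The permutation of that term
  matches the eigenvalues, and it serves all members of the list at once because \<open>R\<close>
  does not depend on the member.\<close>

lemma diagonalizes_unique:
  assumes P: "diagonalizes P As ds" and Q: "diagonalizes Q As es"
  shows "\<exists>\<pi>. \<pi> permutes UNIV \<and> es = map (vperm \<pi>) ds"
proof -
  have inv: "invertible P" "invertible Q"
    using P Q by (simp_all add: diagonalizes_def)
  define R where "R = Q ** matrix_inv P"
  have R: "R ** diagm d = diagm e ** R" if "P ** A = diagm d ** P" "Q ** A = diagm e ** Q" for A d e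
  proof -
    have "R ** diagm d ** P = Q ** A"
      using that(1) inv by (metis R_def matrix_inv_left matrix_mul_assoc matrix_mul_rid)
    also have "\<dots> = diagm e ** R ** P"
      using that(2) inv by (metis R_def matrix_inv_left matrix_mul_assoc matrix_mul_rid)
    finally show ?thesis
      using inv by (simp add: matrix_mul_right_cancel)
  qed
  have "det R \<noteq> 0"
    using inv by (simp add: R_def invertible_matrix_inv invertible_mult flip: invertible_det_nz)
  then obtain \<pi> where \<pi>: "\<pi> permutes UNIV" "(\<Prod>i\<in>UNIV. R $ i $ \<pi> i) \<noteq> 0"
    unfolding det_def by (metis (mono_tags, lifting) mem_Collect_eq mult_zero_right sum.neutral)
  have "e = vperm \<pi> d" if "P ** A = diagm d ** P" "Q ** A = diagm e ** Q" for A d e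
  proof -
    have "R $ i $ \<pi> i * d $ \<pi> i = e $ i * R $ i $ \<pi> i" for i
      using R[OF that] by (metis diagm_mult_nth mult_diagm_nth)
    moreover have "R $ i $ \<pi> i \<noteq> 0" for i
      using \<pi>(2) by simp
    ultimately show ?thesis
      by (metis (no_types, lifting) mult.commute mult_left_cancel vec_eq_iff vperm_nth)
  qed
  then have "es = map (vperm \<pi>) ds"
    using P Q by (auto simp: diagonalizes_def list_all2_conv_all_nth list_eq_iff_nth_eq)
  with \<pi>(1) show ?thesis
    by blast
qed

lemma diagonalizes_conj:
  assumes "diagonalizes P As ds" and "invertible g"
  shows "diagonalizes (P ** matrix_inv g) (conj_tuple g As) ds"
proof -
  have "P ** matrix_inv g ** (g ** A ** matrix_inv g) = diagm d ** (P ** matrix_inv g)"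
    if "P ** A = diagm d ** P" for A d
  proof -
    have "P ** matrix_inv g ** (g ** A ** matrix_inv g)
        = P ** (matrix_inv g ** g) ** A ** matrix_inv g"
      by (simp only: matrix_mul_assoc)
    also have "\<dots> = diagm d ** P ** matrix_inv g"
      using that assms(2) by (simp only: matrix_inv_left matrix_mul_rid)
    finally show ?thesis
      by (simp only: matrix_mul_assoc)
  qed
  then show ?thesis
    using assms
    by (auto simp: diagonalizes_def conj_tuple_def list_all2_conv_all_nth
        invertible_mult invertible_matrix_inv)
qed

lemma conj_tuple_1 [simp]: "conj_tuple (mat 1) As = As"
proof -
  have "invertible (mat 1 :: 'a ^ 3 ^ 3)"
    by (auto simp: invertible_def)
  then have "matrix_inv (mat 1 :: 'a ^ 3 ^ 3) = mat 1"
    using matrix_inv_left by force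
  then show ?thesis
    by (simp add: conj_tuple_def)
qed

section \<open>Rational matrices inside the algebraic closure\<close>

abbreviation ac_matrix :: "'a::field ^ 'n ^ 'm \<Rightarrow> 'a alg_closure ^ 'n ^ 'm" where
  "ac_matrix \<equiv> map_matrix to_ac"

lemma ac_matrix_mult: "ac_matrix (A ** B) = ac_matrix A ** ac_matrix B"
  by (simp add: vec_eq_iff matrix_matrix_mult_def to_ac_sum)

lemma ac_matrix_1 [simp]: "ac_matrix (mat 1) = mat 1"
  by (simp add: vec_eq_iff mat_def)

lemma ac_matrix_eq_iff [simp]: "ac_matrix A = ac_matrix B \<longleftrightarrow> A = B"
  by (simp add: vec_eq_iff)

lemma det_ac_matrix: "det (ac_matrix A :: 'a::field alg_closure ^ 3 ^ 3) = to_ac (det A)"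
  by (simp add: det_3)

lemma invertible_ac_matrix [simp]:
  "invertible (ac_matrix A :: 'a::field alg_closure ^ 3 ^ 3) \<longleftrightarrow> invertible A"
  by (simp add: invertible_det_nz det_ac_matrix)

lemma ac_matrix_inv:
  fixes A :: "'a::field ^ 3 ^ 3"
  assumes "invertible A"
  shows "ac_matrix (matrix_inv A) = matrix_inv (ac_matrix A)"
  by (metis ac_matrix_1 ac_matrix_mult assms invertible_ac_matrix matrix_inv_left
      matrix_inv_right matrix_mul_left_cancel)

lemma ac_conj_tuple:
  "invertible g \<Longrightarrow> map ac_matrix (conj_tuple g As) = conj_tuple (ac_matrix g) (map ac_matrix As)"
  by (simp add: conj_tuple_def ac_matrix_mult ac_matrix_inv)

text \<open>The quotient \<open>R\<close> commutes with each \<open>diagm d\<close>. Its (i, j)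
  entry therefore vanishes as soon as characters i and j differ on some member of
  \<open>ds\<close>.\<close>

lemma diagonalizes_intertwiner:
  assumes P: "diagonalizes P As ds" and Q: "diagonalizes Q As ds"
  obtains R where "Q = R ** P" "invertible R"
    "\<And>d i j. d \<in> set ds \<Longrightarrow> R $ i $ j * d $ j = d $ i * R $ i $ j"
proof
  have inv: "invertible P" "invertible Q"
    using P Q by (simp_all add: diagonalizes_def)
  let ?R = "Q ** matrix_inv P"
  show Q_eq: "Q = ?R ** P"
    by (simp only: matrix_mul_assoc[symmetric] matrix_inv_left[OF inv(1)] matrix_mul_rid)
  show "invertible ?R"
    using inv by (simp add: invertible_matrix_inv invertible_mult)
  fix d i j assume "d \<in> set ds"
  then obtain A where A: "P ** A = diagm d ** P" "Q ** A = diagm d ** Q"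
    using P Q by (fastforce simp: diagonalizes_def list_all2_conv_all_nth in_set_conv_nth)
  have "?R ** diagm d ** P = ?R ** P ** A"
    by (simp only: matrix_mul_assoc[symmetric] A(1))
  also have "\<dots> = diagm d ** ?R ** P"
    unfolding Q_eq[symmetric] A(2) by (subst Q_eq) (simp only: matrix_mul_assoc)
  finally have "?R ** diagm d = diagm d ** ?R"
    by (simp only: matrix_mul_right_cancel[OF inv(1)])
  then show "?R $ i $ j * d $ j = d $ i * ?R $ i $ j"
    by (metis diagm_mult_nth mult_diagm_nth)
qed

section \<open>Permutations of the characters, twisted tori and Lang's theorem\<close>

definition cyc :: "3 \<Rightarrow> 3" where
  "cyc i = i + 1"

definition swap12 :: "3 \<Rightarrow> 3" where
  "swap12 = Transposition.transpose 1 2"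

lemma cyc_simps [simp]: "cyc 1 = 2" "cyc 2 = 3" "cyc 3 = 1"
  by (simp_all add: cyc_def)

lemma swap12_simps [simp]: "swap12 1 = 2" "swap12 2 = 1" "swap12 3 = 3"
  by (simp_all add: swap12_def Transposition.transpose_def)

lemma permutes_cyc: "cyc permutes UNIV"
proof (rule bij_imp_permutes)
  show "bij_betw cyc UNIV UNIV"
    by (rule bij_betw_byWitness[where f' = "\<lambda>i. i - 1"]) (auto simp: cyc_def)
qed simp

lemma permutes_swap12: "swap12 permutes UNIV"
  by (simp add: swap12_def permutes_swap_id)

context finite_field_closure
begin

definition std_perm :: "(3 \<Rightarrow> 3) \<Rightarrow> bool" where
  "std_perm \<sigma> \<longleftrightarrow> \<sigma> = id \<or> \<sigma> = swap12 \<or> \<sigma> = cyc"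

lemma std_perm_permutes: "std_perm \<sigma> \<Longrightarrow> \<sigma> permutes UNIV"
  by (auto simp: std_perm_def permutes_cyc permutes_swap12 permutes_id)

definition twisted_vec :: "(3 \<Rightarrow> 3) \<Rightarrow> 'a alg_closure ^ 3 \<Rightarrow> bool" where
  "twisted_vec \<sigma> d \<longleftrightarrow> (\<forall>j. frob (d $ j) = d $ \<sigma> j)"

definition twisted :: "(3 \<Rightarrow> 3) \<Rightarrow> 'a alg_closure ^ 3 ^ 3 \<Rightarrow> bool" where
  "twisted \<sigma> P \<longleftrightarrow> (\<forall>j k. frob (P $ j $ k) = P $ \<sigma> j $ k)"

text \<open>The rational points of a maximal torus of SL_3, in diagonal coordinates over the
  closure. For \<open>id\<close>, \<open>swap12\<close> and \<open>cyc\<close> they are two copies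
  of the multiplicative group of F_q, the multiplicative group of F_(q^2), and the norm-one elements
  of F_(q^3).\<close>

definition torus :: "(3 \<Rightarrow> 3) \<Rightarrow> ('a alg_closure ^ 3) set" where
  "torus \<sigma> = {d. twisted_vec \<sigma> d \<and> d $ 1 * d $ 2 * d $ 3 = 1}"

abbreviation frob_matrix :: "'a alg_closure ^ 3 ^ 3 \<Rightarrow> 'a alg_closure ^ 3 ^ 3" where
  "frob_matrix \<equiv> map_matrix frob"

lemma frob_matrix_mult: "frob_matrix (A ** B) = frob_matrix A ** frob_matrix B"
  by (simp add: vec_eq_iff matrix_matrix_mult_def frob_sum frob_mult)

lemma det_frob_matrix: "det (frob_matrix A) = frob (det A)"
  by (simp add: det_3 frob_simps)

lemma invertible_frob_matrix [simp]: "invertible (frob_matrix A) \<longleftrightarrow> invertible A"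
  by (simp add: invertible_det_nz det_frob_matrix)

lemma frob_ac_matrix [simp]: "frob_matrix (ac_matrix A) = ac_matrix A"
  by (simp add: vec_eq_iff)

lemma frob_matrix_fixedE:
  assumes "frob_matrix M = M"
  obtains A where "M = ac_matrix A"
proof
  show "M = ac_matrix (\<chi> i j. of_ac (M $ i $ j))"
    using assms by (simp add: vec_eq_iff to_ac_of_ac base_field_iff)
qed

lemma twisted_iff: "twisted \<sigma> P \<longleftrightarrow> frob_matrix P = (\<chi> j. P $ \<sigma> j)"
  by (simp add: twisted_def vec_eq_iff)

lemma twisted_diagm_mult:
  assumes "twisted_vec \<sigma> d" "twisted \<sigma> P"
  shows "twisted \<sigma> (diagm d ** P)"
  using assms by (simp add: twisted_def twisted_vec_def diagm_mult_nth frob_mult)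

text \<open>Permuting rows commutes with multiplication on the right, so \<open>P ** M\<close> and
  \<open>P\<close> carry the same permutation and it cancels. This is how rational matrices are
  obtained, both for existence and for conjugacy.\<close>

lemma twisted_mult_imp_fixed:
  assumes "invertible P" "twisted \<sigma> P" "twisted \<sigma> (P ** M)"
  shows "frob_matrix M = M"
proof -
  have "frob_matrix P ** frob_matrix M = (\<chi> j. (P ** M) $ \<sigma> j)"
    using assms(3) by (simp add: twisted_iff frob_matrix_mult)
  also have "\<dots> = (\<chi> j. P $ \<sigma> j) ** M"
    by (simp add: vec_eq_iff matrix_matrix_mult_def)
  also have "\<dots> = frob_matrix P ** M"
    using assms(2) by (simp add: twisted_iff)
  finally show ?thesis
    using assms(1) by (simp add: matrix_mul_left_cancel)
qed

text \<open>The twist of \<open>P\<close> absorbs that of \<open>d\<close>, so the conjugate of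
  \<open>diagm d\<close> by the inverse of \<open>P\<close> is fixed by Frobenius and has entries in
  F_q.\<close>

lemma diagonalizes_torus_exists:
  assumes P: "invertible P" "twisted \<sigma> P" and ds: "set ds \<subseteq> torus \<sigma>"
  shows "\<exists>As \<in> SL3_tuples (length ds). diagonalizes P (map ac_matrix As) ds"
proof -
  have "\<exists>A. det A = 1 \<and> P ** ac_matrix A = diagm d ** P" if "d \<in> torus \<sigma>" for d
  proof -
    define M where "M = matrix_inv P ** diagm d ** P"
    have M: "P ** M = diagm d ** P"
      unfolding M_def by (simp only: matrix_mul_assoc matrix_inv_right[OF P(1)] matrix_mul_lid)
    with P that have "frob_matrix M = M"
      by (intro twisted_mult_imp_fixed[of P \<sigma>]) (simp_all add: twisted_diagm_mult torus_def)
    then obtain A where A: "M = ac_matrix A"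
      by (rule frob_matrix_fixedE)
    have "det P * to_ac (det A) = det (diagm d) * det P"
      using arg_cong[OF M, of det] by (simp only: det_mul A det_ac_matrix)
    moreover have "det (diagm d) = 1"
      using that by (simp add: det_diagm_3 torus_def)
    ultimately have "to_ac (det A) = 1"
      using P(1) by (simp add: invertible_det_nz)
    then have "det A = 1"
      by (metis to_ac_1 to_ac_eq_iff)
    with M A show ?thesis
      by blast
  qed
  then obtain f where f: "det (f d) = 1 \<and> P ** ac_matrix (f d) = diagm d ** P" if "d \<in> torus \<sigma>" for d
    by metis
  have "map f ds \<in> SL3_tuples (length ds)"
    using f ds by (auto simp: SL3_tuples_def SL3_def)
  moreover have "diagonalizes P (map ac_matrix (map f ds)) ds"
    using f ds P(1) by (auto simp: diagonalizes_def list_all2_conv_all_nth subset_iff)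
  ultimately show ?thesis
    by blast
qed

text \<open>Dividing by \<open>u\<close> gives \<open>u ^ (q ^ n - 1) = inverse c\<close>, which is
  solvable over an algebraically closed field. In the applications \<open>n\<close> is the length of
  a cycle of \<sigma>.\<close>

lemma frob_power_q_fixed_point:
  assumes "c \<noteq> 0" "n > 0"
  shows "\<exists>u. u \<noteq> 0 \<and> u = u ^ (q ^ n) * (c :: 'a alg_closure)"
proof -
  have n: "q ^ n > 1"
    using q_gt_1 assms(2) by (rule one_less_power)
  then obtain u where u: "u ^ (q ^ n - 1) = inverse c"
    using nth_root_exists[of "q ^ n - 1" "inverse c"] by auto
  have "u ^ (q ^ n) = u * u ^ (q ^ n - 1)"
    using q_gt_1 power_minus_mult[of "q ^ n" u] by (simp add: mult.commute)
  moreover have "u \<noteq> 0"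
    using u assms(1) n by (auto simp: power_0_left)
  ultimately show ?thesis
    using u assms(1) by auto
qed

text \<open>Lang's theorem for the (possibly non-split) maximal tori.\<close>

lemma twisted_lang:
  assumes "std_perm \<sigma>" and r: "\<And>i. r $ i \<noteq> 0"
  shows "\<exists>u. (\<forall>i. u $ i \<noteq> 0) \<and> (\<forall>j. frob (u $ j) * r $ \<sigma> j = u $ \<sigma> j)"
proof -
  have "\<sigma> = id \<or> \<sigma> = swap12 \<or> \<sigma> = cyc"
    using assms(1) by (simp add: std_perm_def)
  then show ?thesis
  proof (elim disjE)
    assume \<sigma>: "\<sigma> = id"
    have "\<exists>v. v \<noteq> 0 \<and> v = v ^ (q ^ 1) * r $ j" for j
      using r by (intro frob_power_q_fixed_point) auto
    then obtain v where v: "v j \<noteq> 0" "v j = v j ^ q * r $ j" for j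
      by (metis power_one_right)
    show ?thesis
      using v by (intro exI[of _ "\<chi> j. v j"]) (simp add: \<sigma> frob_def)
  next
    assume \<sigma>: "\<sigma> = swap12"
    \<comment> \<open>Put \<open>v\<close> in position 1. The condition at j = 1 forces
      \<open>v ^ q * r $ 2\<close> in position 2, and the condition at j = 2 leads back to position
      1; the constant is what accumulates around the cycle.\<close>
    obtain v where v: "v \<noteq> 0" "v = v ^ (q ^ 2) * (r $ 2 ^ q * r $ 1)"
      using frob_power_q_fixed_point[of "r $ 2 ^ q * r $ 1" 2] r by auto
    obtain w where w: "w \<noteq> 0" "w = w ^ (q ^ 1) * r $ 3"
      using frob_power_q_fixed_point[of "r $ 3" 1] r by auto
    have "(v ^ q * r $ 2) ^ q * r $ 1 = v"
      using v(2) by (simp add: power_mult_distrib power2_eq_square mult.assoc flip: power_mult)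
    then show ?thesis
      using v w r by (intro exI[of _ "vector [v, v ^ q * r $ 2, w]"]) (simp add: forall_3 \<sigma> frob_def)
  next
    assume \<sigma>: "\<sigma> = cyc"
    \<comment> \<open>The same elimination along the 3-cycle leaves one equation for the first
      coordinate.\<close>
    obtain v where v: "v \<noteq> 0" "v = v ^ (q ^ 3) * ((r $ 2 ^ q * r $ 3) ^ q * r $ 1)"
      using frob_power_q_fixed_point[of "(r $ 2 ^ q * r $ 3) ^ q * r $ 1" 3] r by auto
    have "((v ^ q * r $ 2) ^ q * r $ 3) ^ q * r $ 1 = v"
      using v(2) by (simp add: power_mult_distrib power3_eq_cube mult.assoc flip: power_mult)
    then show ?thesis
      using v r by (intro exI[of _ "vector [v, v ^ q * r $ 2, (v ^ q * r $ 2) ^ q * r $ 3]"])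
        (simp add: forall_3 \<sigma> frob_def)
  qed
qed

text \<open>Surjectivity of the determinant on the torus of GL_3. If \<sigma> fixes position 3, that
  coordinate takes the value \<open>c\<close> alone; for the 3-cycle the claim is surjectivity of
  the norm from F_(q^3), obtained by extracting a root of order 1 + q + q^2.\<close>

lemma twisted_vec_prod_surj:
  assumes "std_perm \<sigma>" and c: "frob c = c" "c \<noteq> 0"
  shows "\<exists>u. twisted_vec \<sigma> u \<and> u $ 1 * u $ 2 * u $ 3 = c"
proof (cases "\<sigma> = cyc")
  case False
  then have "\<sigma> = id \<or> \<sigma> = swap12"
    using assms(1) by (simp add: std_perm_def)
  then show ?thesis
    using c by (intro exI[of _ "vector [1, 1, c]"]) (auto simp: twisted_vec_def forall_3)
next
  case True
  obtain v where v: "v ^ (1 + q + q ^ 2) = c"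
    using nth_root_exists[of "1 + q + q ^ 2" c] by auto
  have "v \<noteq> 0"
    using v c by (auto simp: power_0_left)
  have "v ^ (1 + q + q ^ 2) = v * v ^ q * (v ^ q) ^ q"
    by (simp only: power_add power2_eq_square power_mult power_one_right mult.assoc)
  then have prod: "v * frob v * frob (frob v) = c"
    unfolding frob_def using v by (simp only:)
  \<comment> \<open>Because the norm \<open>c\<close> is rational, applying Frobenius to it replaces
    the factor \<open>v\<close> by its third Frobenius image; cancelling the other two shows that
    \<open>v\<close> lies in F_(q^3).\<close>
  have "frob (v * frob v * frob (frob v)) = v * frob v * frob (frob v)"
    by (simp only: prod c)
  then have "frob (frob (frob v)) = v"
    using \<open>v \<noteq> 0\<close> by (simp add: frob_mult)
  with prod True show ?thesis
    by (intro exI[of _ "vector [v, frob v, frob (frob v)]"]) (simp add: twisted_vec_def forall_3)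
qed

text \<open>The conjugating element is \<open>g\<close>, the inverse of \<open>Q\<close> times
  \<open>diagm u ** P\<close>. Equal twists of \<open>P\<close> and \<open>Q\<close> make it
  rational, \<open>diagm u\<close> commutes with all \<open>diagm d\<close> and so does not disturb
  the conjugation, and \<open>u\<close> is chosen to make the determinant 1.\<close>

lemma diagonalizes_imp_SL3_conj:
  assumes \<sigma>: "std_perm \<sigma>"
    and P: "diagonalizes P (map ac_matrix As) ds" "twisted \<sigma> P"
    and Q: "diagonalizes Q (map ac_matrix Bs) ds" "twisted \<sigma> Q"
  shows "\<exists>g. det g = 1 \<and> Bs = conj_tuple g As"
proof -
  have inv: "invertible P" "invertible Q"
    using P Q by (simp_all add: diagonalizes_def)
  \<comment> \<open>Frobenius multiplies both determinants by the same sign, so their quotient is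
    rational and can serve as the product of the entries of \<open>u\<close>.\<close>
  have "frob (det M) = of_int (sign \<sigma>) * det M" if "twisted \<sigma> M" for M
    using that std_perm_permutes[OF \<sigma>] by (simp add: twisted_iff det_permute_rows flip: det_frob_matrix)
  with P Q inv have c: "frob (det Q / det P) = det Q / det P" "det Q / det P \<noteq> 0"
    by (simp_all add: frob_divide invertible_det_nz sign_def)
  obtain u where u: "twisted_vec \<sigma> u" "u $ 1 * u $ 2 * u $ 3 = det Q / det P"
    using twisted_vec_prod_surj[OF \<sigma> c] by blast
  define M where "M = matrix_inv Q ** (diagm u ** P)"
  have M: "Q ** M = diagm u ** P"
    unfolding M_def by (simp only: matrix_mul_assoc matrix_inv_right[OF inv(2)] matrix_mul_lid)
  then have "frob_matrix M = M"
    using twisted_mult_imp_fixed[OF inv(2) Q(2)] u P(2) by (simp add: twisted_diagm_mult)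
  then obtain g where g: "M = ac_matrix g"
    by (rule frob_matrix_fixedE)
  have "det Q * det M = det Q / det P * det P"
    using arg_cong[OF M, of det] by (simp only: det_mul det_diagm_3 u)
  then have "to_ac (det g) = 1"
    using inv by (simp add: invertible_det_nz g det_ac_matrix)
  then have g1: "det g = 1"
    by (metis to_ac_1 to_ac_eq_iff)
  then have inv_g: "invertible g"
    by (simp add: invertible_det_nz)
  have "g ** A = B ** g"
    if A: "P ** ac_matrix A = diagm d ** P" and B: "Q ** ac_matrix B = diagm d ** Q" for A B d
  proof -
    have "Q ** (M ** ac_matrix A) = diagm u ** diagm d ** P"
      by (simp only: matrix_mul_assoc M) (simp only: matrix_mul_assoc[symmetric] A)
    also have "\<dots> = diagm d ** (Q ** M)"
      by (subst diagm_commute) (simp only: matrix_mul_assoc[symmetric] M)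
    also have "\<dots> = Q ** (ac_matrix B ** M)"
      by (simp only: matrix_mul_assoc B)
    finally have "M ** ac_matrix A = ac_matrix B ** M"
      by (simp only: matrix_mul_left_cancel[OF inv(2)])
    then show ?thesis
      by (simp add: g flip: ac_matrix_mult)
  qed
  then have "list_all2 (\<lambda>A B. g ** A ** matrix_inv g = B) As Bs"
    using P(1) Q(1) inv_g
    by (auto simp: diagonalizes_def list_all2_conv_all_nth invertible_conj_eq_iff)
  then have "Bs = conj_tuple g As"
    by (auto simp: conj_tuple_def list_all2_conv_all_nth list_eq_iff_nth_eq)
  with g1 show ?thesis
    by blast
qed

section \<open>Diagonalizers compatible with Frobenius\<close>

definition frob_vec :: "'a alg_closure ^ 3 \<Rightarrow> 'a alg_closure ^ 3" where
  "frob_vec d = (\<chi> j. frob (d $ j))"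

lemma diagonalizes_frob:
  assumes "diagonalizes P (map ac_matrix As) ds"
  shows "diagonalizes (frob_matrix P) (map ac_matrix As) (map frob_vec ds)"
proof -
  have "frob_matrix P ** ac_matrix A = diagm (frob_vec d) ** frob_matrix P"
    if "P ** ac_matrix A = diagm d ** P" for A d
  proof -
    have "frob_matrix (diagm d) = diagm (frob_vec d)"
      by (simp add: vec_eq_iff diagm_def frob_vec_def)
    then show ?thesis
      using arg_cong[OF that, of frob_matrix] by (simp add: frob_matrix_mult)
  qed
  with assms show ?thesis
    by (auto simp: diagonalizes_def list_all2_conv_all_nth)
qed

text \<open>Applying Frobenius to \<open>P\<close> and undoing the permutation of rows gives a
  second diagonalizer for the same \<open>ds\<close>. Distinct characters force the intertwiner to
  be diagonal, and Lang's theorem removes a diagonal factor.\<close>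

lemma twisted_diagonalizer_distinct:
  assumes \<sigma>: "std_perm \<sigma>" and P: "diagonalizes P (map ac_matrix As) ds"
    and ds: "\<And>d. d \<in> set ds \<Longrightarrow> twisted_vec \<sigma> d"
    and distinct: "\<And>i j. i \<noteq> j \<Longrightarrow> \<exists>d \<in> set ds. d $ i \<noteq> d $ j"
  shows "\<exists>Q. diagonalizes Q (map ac_matrix As) ds \<and> twisted \<sigma> Q"
proof -
  note perm = std_perm_permutes[OF \<sigma>]
  define \<tau> where "\<tau> = Hilbert_Choice.inv \<sigma>"
  have \<tau>: "\<tau> permutes UNIV" and \<sigma>\<tau>: "\<sigma> (\<tau> i) = i" and \<tau>\<sigma>: "\<tau> (\<sigma> i) = i" for i
    using perm by (simp_all add: \<tau>_def permutes_inv permutes_inverses)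
  have "map (vperm \<tau>) (map frob_vec ds) = ds"
    using ds by (intro nth_equalityI) (auto simp: vec_eq_iff frob_vec_def twisted_vec_def \<sigma>\<tau>)
  with diagonalizes_vperm[OF diagonalizes_frob[OF P] \<tau>]
  have P2: "diagonalizes (\<chi> i. frob_matrix P $ \<tau> i) (map ac_matrix As) ds"
    by simp
  obtain R where R: "(\<chi> i. frob_matrix P $ \<tau> i) = R ** P" "invertible R"
    and comm: "\<And>d i j. d \<in> set ds \<Longrightarrow> R $ i $ j * d $ j = d $ i * R $ i $ j"
    using diagonalizes_intertwiner[OF P P2] by metis
  have off: "R $ i $ j = 0" if "i \<noteq> j" for i j
    using distinct[OF that] comm by (metis mult.commute mult_left_cancel)
  define r where "r = (\<chi> i. R $ i $ i)"
  have R_diag: "R = diagm r"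
    using off by (auto simp: vec_eq_iff diagm_def r_def)
  have "det R \<noteq> 0"
    using R(2) by (simp add: invertible_det_nz)
  then have r: "r $ i \<noteq> 0" for i
    by (simp add: R_diag det_diagm)
  \<comment> \<open>Scaling row j of \<open>P\<close> by \<open>u $ j\<close> compensates the factor
    \<open>r $ \<sigma> j\<close> that Frobenius introduces.\<close>
  obtain u where u: "\<And>i. u $ i \<noteq> 0" "\<And>j. frob (u $ j) * r $ \<sigma> j = u $ \<sigma> j"
    using twisted_lang[OF \<sigma> r] by blast
  have frob_P: "frob (P $ j $ k) = r $ \<sigma> j * P $ \<sigma> j $ k" for j k
  proof -
    have "(\<chi> i. frob_matrix P $ \<tau> i) $ \<sigma> j $ k = r $ \<sigma> j * P $ \<sigma> j $ k"
      unfolding R R_diag diagm_mult_nth ..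
    then show ?thesis
      by (simp add: \<tau>\<sigma>)
  qed
  have "twisted \<sigma> (diagm u ** P)"
    using u(2) by (simp add: twisted_def diagm_mult_nth frob_mult frob_P mult.assoc[symmetric])
  moreover have "diagonalizes (diagm u ** P) (map ac_matrix As) ds"
  proof -
    have "invertible (diagm u ** P)"
      using P u(1) by (simp add: diagonalizes_def invertible_det_nz det_mul det_diagm)
    moreover have "diagm u ** P ** A = diagm d ** (diagm u ** P)"
      if "P ** A = diagm d ** P" for A d
      by (simp only: that matrix_mul_assoc[symmetric]) (simp only: matrix_mul_assoc diagm_commute[of u d])
    ultimately show ?thesis
      using P by (auto simp: diagonalizes_def list_all2_conv_all_nth)
  qed
  ultimately show ?thesis
    by blast
qed

text \<open>A scalar matrix equals all its conjugates, so the tuple is already diagonal and the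
  identity matrix diagonalizes it.\<close>

lemma twisted_diagonalizer_scalar:
  assumes P: "diagonalizes P (map ac_matrix As) ds"
    and scalar: "\<And>d i j. d \<in> set ds \<Longrightarrow> d $ i = d $ j"
  shows "\<exists>Q. diagonalizes Q (map ac_matrix As) ds \<and> twisted id Q"
proof (intro exI conjI)
  have inv: "invertible P"
    using P by (simp add: diagonalizes_def)
  have "A = diagm d" if A: "P ** A = diagm d ** P" and d: "d \<in> set ds" for A d
  proof -
    have "diagm d ** P = P ** diagm d"
      using scalar[OF d]
      by (auto simp: vec_eq_iff diagm_mult_nth mult_diagm_nth mult.commute)
    with A inv show ?thesis
      by (simp add: matrix_mul_left_cancel)
  qed
  moreover have "invertible (mat 1 :: 'a alg_closure ^ 3 ^ 3)"
    by (simp add: invertible_det_nz)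
  ultimately show "diagonalizes (mat 1) (map ac_matrix As) ds"
    using P by (auto simp: diagonalizes_def list_all2_conv_all_nth)
  show "twisted id (mat 1)"
    by (simp add: twisted_def mat_def)
qed

text \<open>The vectors (-x_2, x_1, 0), (-x_3, 0, x_1) and (0, -x_3, x_2) are rational and
  orthogonal to \<open>x\<close>. Two of them together with \<open>y\<close> have determinant x_i
  times the pairing of \<open>y\<close> and \<open>x\<close>, that is x_i; the choice of two depends
  on which x_i is nonzero.\<close>

lemma fixed_basis_completion:
  fixes x y :: "'a alg_closure ^ 3"
  assumes x: "\<And>i. frob (x $ i) = x $ i" and y: "\<And>i. frob (y $ i) = y $ i"
    and xy: "y $ 1 * x $ 1 + y $ 2 * x $ 2 + y $ 3 * x $ 3 = 1"
  shows "\<exists>Q. twisted id Q \<and> invertible Q \<and> Q $ 3 = y \<and>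
    (\<Sum>k\<in>UNIV. Q $ 1 $ k * x $ k) = 0 \<and> (\<Sum>k\<in>UNIV. Q $ 2 $ k * x $ k) = 0"
proof -
  have dets: "det (vector [vector [- x $ 2, x $ 1, 0], vector [- x $ 3, 0, x $ 1], y]) = x $ 1"
    "det (vector [vector [- x $ 2, x $ 1, 0], vector [0, - x $ 3, x $ 2], y]) = x $ 2"
    "det (vector [vector [- x $ 3, 0, x $ 1], vector [0, - x $ 3, x $ 2], y]) = x $ 3"
    using arg_cong[OF xy, of "(*) (x $ 1)"] arg_cong[OF xy, of "(*) (x $ 2)"]
      arg_cong[OF xy, of "(*) (x $ 3)"]
    by (simp_all add: det_3 algebra_simps)
  have "x $ 1 \<noteq> 0 \<or> x $ 2 \<noteq> 0 \<or> x $ 3 \<noteq> 0"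
    using xy by auto
  then show ?thesis
  proof (elim disjE)
    assume "x $ 1 \<noteq> 0"
    with dets(1) x y show ?thesis
      by (intro exI[of _ "vector [vector [- x $ 2, x $ 1, 0], vector [- x $ 3, 0, x $ 1], y]"])
        (simp add: twisted_def forall_3 sum_3 frob_simps invertible_det_nz)
  next
    assume "x $ 2 \<noteq> 0"
    with dets(2) x y show ?thesis
      by (intro exI[of _ "vector [vector [- x $ 2, x $ 1, 0], vector [0, - x $ 3, x $ 2], y]"])
        (simp add: twisted_def forall_3 sum_3 frob_simps invertible_det_nz)
  next
    assume "x $ 3 \<noteq> 0"
    with dets(3) x y show ?thesis
      by (intro exI[of _ "vector [vector [- x $ 3, 0, x $ 1], vector [0, - x $ 3, x $ 2], y]"])
        (simp add: twisted_def forall_3 sum_3 frob_simps invertible_det_nz)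
  qed
qed

text \<open>Here the eigenspace of the repeated character is the orthogonal complement of a column
  \<open>x\<close> of \<open>P\<inverse>\<close>, and \<open>x\<close> can be rescaled to be rational.\<close>

lemma twisted_diagonalizer_repeating:
  assumes P: "diagonalizes P (map ac_matrix As) ds"
    and ds: "\<And>d. d \<in> set ds \<Longrightarrow> twisted_vec id d"
    and rep: "\<And>d. d \<in> set ds \<Longrightarrow> d $ 1 = d $ 2"
    and d0: "d0 \<in> set ds" "d0 $ 1 \<noteq> d0 $ 3"
  shows "\<exists>Q. diagonalizes Q (map ac_matrix As) ds \<and> twisted id Q"
proof -
  have inv: "invertible P"
    using P by (simp add: diagonalizes_def)
  have "frob_vec d = d" if "d \<in> set ds" for d
    using ds[OF that] by (simp add: vec_eq_iff frob_vec_def twisted_vec_def)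
  then have "map frob_vec ds = ds"
    by (simp add: map_idI)
  with diagonalizes_frob[OF P] have "diagonalizes (frob_matrix P) (map ac_matrix As) ds"
    by simp
  then obtain R where R: "frob_matrix P = R ** P" "invertible R"
    and comm: "\<And>d i j. d \<in> set ds \<Longrightarrow> R $ i $ j * d $ j = d $ i * R $ i $ j"
    using diagonalizes_intertwiner[OF P] by metis
  have R0: "R $ i $ j = 0" if "d0 $ i \<noteq> d0 $ j" for i j
    using that comm[OF d0(1), of i j] by (metis mult.commute mult_left_cancel)
  have d02: "d0 $ 2 \<noteq> d0 $ 3"
    using d0(2) rep[OF d0(1)] by simp
  \<comment> \<open>Commuting with \<open>d0\<close> splits \<open>R\<close> into a block of size 2
    and the scalar \<open>c\<close>. Lang's theorem for a torus does not apply to the block, so only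
    row 3 of \<open>P\<close> and column 3 of its inverse are used.\<close>
  have R_zero: "R $ 1 $ 3 = 0" "R $ 2 $ 3 = 0" "R $ 3 $ 1 = 0" "R $ 3 $ 2 = 0"
    using d0(2) d02 by (auto intro!: R0)
  define c where "c = R $ 3 $ 3"
  have "det R \<noteq> 0"
    using R(2) by (simp add: invertible_det_nz)
  then have c: "c \<noteq> 0"
    by (auto simp: det_3 R_zero c_def)
  define V where "V = matrix_inv P"
  have PV: "P ** V = mat 1" and VP: "V ** P = mat 1"
    using inv by (simp_all add: V_def matrix_inv_left matrix_inv_right)
  have frob_y: "frob (P $ 3 $ k) = c * P $ 3 $ k" for k
  proof -
    have "frob_matrix P $ 3 $ k = (R ** P) $ 3 $ k"
      by (simp only: R(1))
    then show ?thesis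
      by (simp add: matrix_matrix_mult_def sum_3 R_zero c_def)
  qed
  \<comment> \<open>Frobenius applied to \<open>V ** P = mat 1\<close> gives
    \<open>frob_matrix V ** R = V\<close>, and column 3 of \<open>R\<close> is zero apart from
    \<open>c\<close>.\<close>
  have frob_x: "frob (V $ k $ 3) * c = V $ k $ 3" for k
  proof -
    have "frob_matrix V ** R = frob_matrix V ** (R ** P) ** V"
      by (simp only: matrix_mul_assoc[symmetric] PV matrix_mul_rid)
    also have "\<dots> = V"
      by (simp only: R(1)[symmetric] frob_matrix_mult[symmetric] VP)
        (simp add: vec_eq_iff mat_def matrix_matrix_mult_def if_distrib[of "\<lambda>x. x * _"] if_distrib[of frob] cong: if_cong)
    finally have "(frob_matrix V ** R) $ k $ 3 = V $ k $ 3"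
      by simp
    then show ?thesis
      by (simp add: matrix_matrix_mult_def sum_3 R_zero c_def)
  qed
  \<comment> \<open>Frobenius multiplies row 3 of \<open>P\<close> by \<open>c\<close> and divides
    column 3 of \<open>V\<close> by \<open>c\<close>. So one scalar makes both rational: multiply
    the row by it and divide the column by it.\<close>
  obtain u where u: "u \<noteq> 0" "frob u * c = u"
    using frob_power_q_fixed_point[OF c, of 1] by (auto simp: frob_def)
  define y where "y = (\<chi> k. u * P $ 3 $ k)"
  define x where "x = (\<chi> k. V $ k $ 3 / u)"
  have y_fixed: "frob (y $ k) = y $ k" for k
    using u(2) frob_y[of k] by (simp add: y_def frob_mult flip: mult.assoc)
  have x_fixed: "frob (x $ k) = x $ k" for k
  proof -
    have "frob (V $ k $ 3) / frob u = (frob (V $ k $ 3) * c) / (frob u * c)"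
      using c by simp
    then show ?thesis
      by (simp add: x_def frob_divide frob_x u(2))
  qed
  have "(P ** V) $ 3 $ 3 = 1"
    by (simp add: PV mat_def)
  then have yx: "y $ 1 * x $ 1 + y $ 2 * x $ 2 + y $ 3 * x $ 3 = 1"
    using u(1) by (simp add: x_def y_def matrix_matrix_mult_def sum_3)
  obtain Q where Q: "twisted id Q" "invertible Q" "Q $ 3 = y"
    and Qx: "(\<Sum>k\<in>UNIV. Q $ 1 $ k * x $ k) = 0" "(\<Sum>k\<in>UNIV. Q $ 2 $ k * x $ k) = 0"
    using fixed_basis_completion[OF x_fixed y_fixed yx] by blast
  have "Q ** A = diagm d ** Q" if A: "P ** A = diagm d ** P" and d: "d \<in> set ds" for A d
  proof -
    have "A = V ** (P ** A)"
      by (simp only: matrix_mul_assoc VP matrix_mul_lid)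
    then have A_eq: "A $ i $ k = (\<Sum>j\<in>UNIV. V $ i $ j * (d $ j * P $ j $ k))" for i k
      unfolding A by (simp add: matrix_matrix_mult_def[of V] diagm_mult_nth)
    have VP_nth: "(\<Sum>j\<in>UNIV. V $ i $ j * P $ j $ k) = (if i = k then 1 else 0)" for i k
      using VP by (simp add: vec_eq_iff matrix_matrix_mult_def mat_def)
    \<comment> \<open>Since the first two characters agree, \<open>A\<close> is a scalar plus a
      rank-one matrix: d_1 times the identity plus (d_3 - d_1) times column \<open>x\<close> times
      row \<open>y\<close>. A row orthogonal to \<open>x\<close> is thus an eigenvector for d_1, and
      \<open>y\<close>, whose pairing with \<open>x\<close> is 1, is one for d_3.\<close>
    have A_nth: "A $ i $ k = d $ 1 * (if i = k then 1 else 0) + (d $ 3 - d $ 1) * x $ i * y $ k" for i k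
      using u(1) rep[OF d] unfolding A_eq VP_nth[symmetric]
      by (simp add: sum_3 x_def y_def algebra_simps)
    have QA: "(Q ** A) $ j $ k
        = d $ 1 * Q $ j $ k + (d $ 3 - d $ 1) * (\<Sum>i\<in>UNIV. Q $ j $ i * x $ i) * y $ k" for j k
    proof -
      have "(Q ** A) $ j $ k = (\<Sum>i\<in>UNIV. d $ 1 * (Q $ j $ i * (if i = k then 1 else 0)))
          + (\<Sum>i\<in>UNIV. (d $ 3 - d $ 1) * (Q $ j $ i * x $ i) * y $ k)"
        unfolding sum.distrib[symmetric] matrix_matrix_mult_def A_nth
        by (simp add: algebra_simps cong: sum.cong if_cong)
      then show ?thesis
        by (simp add: sum_distrib_left[symmetric] sum_distrib_right[symmetric]
            if_distrib[of "\<lambda>x. _ * x"] cong: if_cong)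
    qed
    have "(\<Sum>k\<in>UNIV. Q $ 3 $ k * x $ k) = 1"
      using yx by (simp add: Q(3) sum_3)
    then have "(Q ** A) $ 3 $ k = d $ 3 * Q $ 3 $ k" for k
      by (simp add: QA Q(3) algebra_simps)
    moreover have "(Q ** A) $ 1 $ k = d $ 1 * Q $ 1 $ k" "(Q ** A) $ 2 $ k = d $ 2 * Q $ 2 $ k" for k
      using rep[OF d] by (simp_all add: QA Qx)
    ultimately have "\<forall>j. \<forall>k. (Q ** A) $ j $ k = (diagm d ** Q) $ j $ k"
      unfolding diagm_mult_nth forall_3[of "\<lambda>j. \<forall>k. _ j k"] by blast
    then show ?thesis
      by (simp add: vec_eq_iff)
  qed
  with P Q(2) have "diagonalizes Q (map ac_matrix As) ds"
    by (auto simp: diagonalizes_def list_all2_conv_all_nth)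
  with Q(1) show ?thesis
    by blast
qed

end

section \<open>Orbits and their lists of eigenvalues\<close>

lemma orbit_SL3:
  assumes "As \<in> SL3_tuples r"
  shows "orbit SL3 (conj_action r) As = {conj_tuple g As | g. det g = 1}"
  using assms by (auto simp: orbit_def conj_action_def SL3_def)

lemma conj_tuple_SL3_tuples:
  fixes g :: "'a::field ^ 3 ^ 3"
  assumes "invertible g" "As \<in> SL3_tuples r"
  shows "conj_tuple g As \<in> SL3_tuples r"
proof -
  have "det g * det (matrix_inv g) = 1"
    by (metis assms(1) det_I det_mul matrix_inv_right)
  then have "det (g ** A ** matrix_inv g) = det A" for A
    by (simp add: det_mul mult.commute mult.left_commute)
  with assms(2) show ?thesis
    by (auto simp: SL3_tuples_def SL3_def conj_tuple_def)
qed

lemma diagonal_tuple_diagm: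
  "diagonal_tuple (map diagm ds) \<longleftrightarrow> (\<forall>d \<in> set ds. d $ 1 * d $ 2 * d $ 3 = 1)"
  unfolding diagonal_tuple_def SL3_def by (simp add: det_diagm_3)

lemma card_eq_mult_card_image:
  assumes "finite Y" and "\<And>x. x \<in> Y \<Longrightarrow> card {y \<in> Y. f y = f x} = m"
  shows "card Y = m * card (f ` Y)"
proof -
  have "card Y = (\<Sum>z\<in>f ` Y. card {y \<in> Y. f y = z})"
    using sum.image_gen[OF assms(1), of "\<lambda>_. 1 :: nat" f] by simp
  also have "\<dots> = (\<Sum>z\<in>f ` Y. m)"
    using assms(2) by (intro sum.cong) auto
  finally show ?thesis
    by simp
qed

text \<open>The three characters are pairwise distinct on the tuple as a whole; a single member need
  not have three distinct entries.\<close>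

definition separating :: "('b ^ 3) list \<Rightarrow> bool" where
  "separating ds \<longleftrightarrow> (\<forall>i j. i \<noteq> j \<longrightarrow> (\<exists>d \<in> set ds. d $ i \<noteq> d $ j))"

lemma separating_vperm:
  assumes "separating ds" "\<pi> permutes UNIV"
  shows "separating (map (vperm \<pi>) ds)"
  using assms by (simp add: separating_def) (metis permutes_inj injD)

lemma separating_vperm_eq_iff:
  assumes "separating ds"
  shows "map (vperm \<pi>) ds = map (vperm \<rho>) ds \<longleftrightarrow> \<pi> = \<rho>"
  using assms by (auto simp: separating_def vec_eq_iff fun_eq_iff)

context finite_field_closure
begin

definition has_eigs :: "('a ^ 3 ^ 3) list \<Rightarrow> ('a alg_closure ^ 3) list \<Rightarrow> bool" where
  "has_eigs As ds \<longleftrightarrow> (\<exists>P. diagonalizes P (map ac_matrix As) ds)"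

lemma has_eigs_length: "has_eigs As ds \<Longrightarrow> length ds = length As"
  by (auto simp: has_eigs_def diagonalizes_def dest: list_all2_lengthD)

lemma has_eigs_vperm: "has_eigs As ds \<Longrightarrow> \<pi> permutes UNIV \<Longrightarrow> has_eigs As (map (vperm \<pi>) ds)"
  unfolding has_eigs_def using diagonalizes_vperm by blast

lemma has_eigs_unique:
  "has_eigs As ds \<Longrightarrow> has_eigs As es \<Longrightarrow> \<exists>\<pi>. \<pi> permutes UNIV \<and> es = map (vperm \<pi>) ds"
  unfolding has_eigs_def using diagonalizes_unique by blast

lemma has_eigs_conj:
  assumes "has_eigs As ds" "invertible g"
  shows "has_eigs (conj_tuple g As) ds"
  using assms diagonalizes_conj[of _ "map ac_matrix As" ds "ac_matrix g"]
  by (auto simp: has_eigs_def ac_conj_tuple)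

text \<open>A rational tuple is also diagonalized by the Frobenius image of a diagonalizer, with
  Frobenius images as eigenvalues; uniqueness of eigenvalues supplies the permutation.\<close>

lemma has_eigs_twisted:
  assumes "has_eigs As ds"
  shows "\<exists>\<pi>. \<pi> permutes UNIV \<and> (\<forall>d \<in> set ds. twisted_vec \<pi> d)"
proof -
  have "has_eigs As (map frob_vec ds)"
    using assms diagonalizes_frob unfolding has_eigs_def by blast
  with assms obtain \<pi> where \<pi>: "\<pi> permutes UNIV" "map frob_vec ds = map (vperm \<pi>) ds"
    using has_eigs_unique by blast
  then have "frob (d $ j) = d $ \<pi> j" if "d \<in> set ds" for d j
    using that by (auto simp: vec_eq_iff frob_vec_def)
  with \<pi>(1) show ?thesis
    by (auto simp: twisted_vec_def)
qed

lemma closed_tuples_iff: "As \<in> closed_tuples r \<longleftrightarrow> As \<in> SL3_tuples r \<and> (\<exists>ds. has_eigs As ds)"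
proof -
  have "(\<forall>D \<in> set Ds. diagonal_matrix D) \<longleftrightarrow> (\<exists>ds. Ds = map diagm ds)" for Ds :: "('a alg_closure ^ 3 ^ 3) list"
  proof
    assume "\<forall>D \<in> set Ds. diagonal_matrix D"
    then have "Ds = map diagm (map (\<lambda>D. \<chi> i. D $ i $ i) Ds)"
      by (intro nth_equalityI) (auto simp: vec_eq_iff diagm_def diagonal_matrix_def)
    then show "\<exists>ds. Ds = map diagm ds" ..
  qed auto
  then show ?thesis
    by (auto simp: closed_tuples_def has_eigs_def diagonalizes_iff_conj_tuple)
qed

lemma stratum_iff:
  assumes "\<And>Ds. S Ds \<Longrightarrow> diagonal_tuple Ds"
  shows "As \<in> stratum S r \<longleftrightarrow> As \<in> SL3_tuples r \<and> (\<exists>ds. has_eigs As ds \<and> S (map diagm ds))"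
proof -
  have "\<exists>ds. Ds = map diagm ds" if "S Ds" for Ds
  proof
    show "Ds = map diagm (map (\<lambda>D. \<chi> i. D $ i $ i) Ds)"
      using assms[OF that]
      by (intro nth_equalityI) (auto simp: vec_eq_iff diagm_def diagonal_matrix_def diagonal_tuple_def)
  qed
  then show ?thesis
    unfolding stratum_def has_eigs_def diagonalizes_iff_conj_tuple by (auto, metis+)
qed

text \<open>The counting scheme shared by all strata. \<open>Y\<close> consists of normal forms of
  eigenvalue lists: \<open>normal\<close> says that every tuple of the stratum has one,
  \<open>twist\<close> that each is realized, \<open>normalizer\<close> that tuples with the same
  list are conjugate. Orbits then correspond to lists in \<open>Y\<close> up to permutation, in
  classes of constant size \<open>m\<close>.\<close>

lemma card_eq_mult_num_closed_orbits:
  assumes fin: "finite Y" and \<sigma>: "std_perm \<sigma>"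
    and diag: "\<And>Ds. S Ds \<Longrightarrow> diagonal_tuple Ds"
    and Y: "\<And>ds. ds \<in> Y \<Longrightarrow> length ds = r \<and> set ds \<subseteq> torus \<sigma> \<and> S (map diagm ds)"
    and normal: "\<And>ds \<pi>. length ds = r \<Longrightarrow> S (map diagm ds) \<Longrightarrow> \<pi> permutes UNIV \<Longrightarrow>
      \<forall>d \<in> set ds. twisted_vec \<pi> d \<Longrightarrow> \<exists>\<rho>. \<rho> permutes UNIV \<and> map (vperm \<rho>) ds \<in> Y"
    and twist: "\<And>ds. ds \<in> Y \<Longrightarrow> \<exists>P. invertible P \<and> twisted \<sigma> P"
    and normalizer: "\<And>As ds. ds \<in> Y \<Longrightarrow> has_eigs As ds \<Longrightarrow>
      \<exists>Q. diagonalizes Q (map ac_matrix As) ds \<and> twisted \<sigma> Q"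
    and fibre: "\<And>ds. ds \<in> Y \<Longrightarrow>
      card {es \<in> Y. \<exists>\<pi>. \<pi> permutes UNIV \<and> es = map (vperm \<pi>) ds} = m"
  shows "card Y = m * num_closed_orbits r S"
proof -
  define f where "f ds = {As \<in> SL3_tuples r. has_eigs As ds}" for ds
  have exists: "\<exists>As \<in> SL3_tuples r. has_eigs As ds" if "ds \<in> Y" for ds
    using Y[OF that] twist[OF that] diagonalizes_torus_exists unfolding has_eigs_def by blast
  have stratumI: "As \<in> stratum S r" if "As \<in> SL3_tuples r" "ds \<in> Y" "has_eigs As ds" for As ds
    using that Y by (auto simp: stratum_iff[OF diag])
  have stratumD: "\<exists>ds \<in> Y. has_eigs As ds" if As: "As \<in> stratum S r" for As
  proof -
    obtain ds where ds: "has_eigs As ds" "S (map diagm ds)" and "As \<in> SL3_tuples r"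
      using As by (auto simp: stratum_iff[OF diag])
    moreover then have "length ds = r"
      using has_eigs_length by (auto simp: SL3_tuples_def)
    ultimately show ?thesis
      using normal has_eigs_twisted[OF ds(1)] has_eigs_vperm[OF ds(1)] by metis
  qed
  \<comment> \<open>Conjugation keeps the eigenvalues; conversely, two tuples with eigenvalues
    \<open>ds\<close> have diagonalizers with the same twist and so are conjugate under
    SL_3(F_q).\<close>
  have orbit_eq: "orbit SL3 (conj_action r) As = f ds"
    if "As \<in> SL3_tuples r" "ds \<in> Y" "has_eigs As ds" for As ds
  proof -
    have "conj_tuple g As \<in> f ds" if "det g = 1" for g
      using \<open>As \<in> SL3_tuples r\<close> \<open>has_eigs As ds\<close> that
      by (simp add: f_def conj_tuple_SL3_tuples has_eigs_conj invertible_det_nz)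
    moreover have "\<exists>g. det g = 1 \<and> Bs = conj_tuple g As" if "Bs \<in> f ds" for Bs
    proof -
      obtain P Q where "diagonalizes P (map ac_matrix As) ds" "twisted \<sigma> P"
        "diagonalizes Q (map ac_matrix Bs) ds" "twisted \<sigma> Q"
        using normalizer \<open>ds \<in> Y\<close> \<open>has_eigs As ds\<close> \<open>Bs \<in> f ds\<close> unfolding f_def by blast
      then show ?thesis
        using diagonalizes_imp_SL3_conj[OF \<sigma>] by blast
    qed
    ultimately show ?thesis
      using that by (auto simp: orbit_SL3)
  qed
  have "{Orb \<in> closed_orbits r. Orb \<subseteq> stratum S r} = f ` Y"
  proof (intro equalityI subsetI)
    fix Orb assume "Orb \<in> {Orb \<in> closed_orbits r. Orb \<subseteq> stratum S r}"
    then obtain As where As: "As \<in> closed_tuples r" "Orb = orbit SL3 (conj_action r) As"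
      and sub: "Orb \<subseteq> stratum S r"
      by (auto simp: closed_orbits_def orbits_def)
    then have SL: "As \<in> SL3_tuples r"
      by (simp add: closed_tuples_iff)
    moreover have "As \<in> Orb"
      using As(2) orbit_SL3[OF SL] conj_tuple_1[of As] det_I by (metis (mono_tags, lifting) mem_Collect_eq)
    ultimately obtain ds where "ds \<in> Y" "has_eigs As ds"
      using stratumD sub by blast
    with orbit_eq[OF SL] As(2) show "Orb \<in> f ` Y"
      by blast
  next
    fix Orb assume "Orb \<in> f ` Y"
    then obtain ds where ds: "ds \<in> Y" "Orb = f ds"
      by blast
    obtain As where As: "As \<in> SL3_tuples r" "has_eigs As ds"
      using exists[OF ds(1)] by blast
    have "Orb \<in> closed_orbits r"
      using ds As orbit_eq[OF As(1) ds(1) As(2)]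
      by (auto simp: closed_orbits_def orbits_def closed_tuples_iff)
    moreover have "Orb \<subseteq> stratum S r"
      using ds stratumI by (auto simp: f_def)
    ultimately show "Orb \<in> {Orb \<in> closed_orbits r. Orb \<subseteq> stratum S r}"
      by simp
  qed
  then have num: "num_closed_orbits r S = card (f ` Y)"
    by (simp add: num_closed_orbits_def)
  have "f es = f ds \<longleftrightarrow> (\<exists>\<pi>. \<pi> permutes UNIV \<and> es = map (vperm \<pi>) ds)"
    if Y: "ds \<in> Y" "es \<in> Y" for ds es
  proof
    assume "f es = f ds"
    then obtain As where "has_eigs As ds" "has_eigs As es"
      using exists[OF Y(1)] unfolding f_def by blast
    then show "\<exists>\<pi>. \<pi> permutes UNIV \<and> es = map (vperm \<pi>) ds"
      by (rule has_eigs_unique)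
  next
    assume "\<exists>\<pi>. \<pi> permutes UNIV \<and> es = map (vperm \<pi>) ds"
    then obtain \<pi> where \<pi>: "\<pi> permutes UNIV" and es: "es = map (vperm \<pi>) ds"
      by blast
    have "map (vperm (Hilbert_Choice.inv \<pi>)) es = ds"
      using \<pi> by (intro nth_equalityI) (simp_all add: es vec_eq_iff permutes_inverses)
    then have "has_eigs As es \<longleftrightarrow> has_eigs As ds" for As
      using has_eigs_vperm \<pi> es by (metis permutes_inv)
    then show "f es = f ds"
      by (simp add: f_def)
  qed
  then have "{es \<in> Y. f es = f ds} = {es \<in> Y. \<exists>\<pi>. \<pi> permutes UNIV \<and> es = map (vperm \<pi>) ds}"
    if "ds \<in> Y" for ds
    using that by blast
  with fibre fin show ?thesis
    unfolding num by (intro card_eq_mult_card_image) simp_all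
qed

section \<open>Tuples with pairwise distinct characters\<close>

definition separating_lists :: "(3 \<Rightarrow> 3) \<Rightarrow> nat \<Rightarrow> ('a alg_closure ^ 3) list set" where
  "separating_lists \<sigma> r = {ds. length ds = r \<and> set ds \<subseteq> torus \<sigma> \<and> separating ds}"

text \<open>At position j the condition compares the characters numbered
  \<open>\<sigma> (\<pi> j)\<close> and \<open>\<pi> (\<tau> j)\<close>. As distinct characters
  differ on the tuple, agreement of values means equality of indices.\<close>

lemma twisted_vec_vperm_iff:
  assumes "separating ds" "\<forall>d \<in> set ds. twisted_vec \<sigma> d"
  shows "(\<forall>d \<in> set ds. twisted_vec \<tau> (vperm \<pi> d)) \<longleftrightarrow> \<sigma> \<circ> \<pi> = \<pi> \<circ> \<tau>"
  using assms unfolding separating_def twisted_vec_def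
  by (simp add: fun_eq_iff) metis

lemma vperm_prod_3:
  fixes d :: "'b::comm_monoid_mult ^ 3"
  assumes "\<pi> permutes UNIV"
  shows "vperm \<pi> d $ 1 * vperm \<pi> d $ 2 * vperm \<pi> d $ 3 = d $ 1 * d $ 2 * d $ 3"
proof -
  have "(\<Prod>i\<in>UNIV. d $ \<pi> i) = (\<Prod>i\<in>UNIV. d $ i)"
    using prod.permute[OF assms, of "\<lambda>i. d $ i"] by (simp add: o_def)
  then show ?thesis
    unfolding UNIV_3 by (simp add: mult.assoc)
qed

lemma separating_lists_vperm_iff:
  assumes "separating ds" "\<forall>d \<in> set ds. twisted_vec \<sigma> d \<and> d $ 1 * d $ 2 * d $ 3 = 1" "length ds = r"
    and "\<pi> permutes UNIV"
  shows "map (vperm \<pi>) ds \<in> separating_lists \<tau> r \<longleftrightarrow> \<sigma> \<circ> \<pi> = \<pi> \<circ> \<tau>"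
proof -
  have "map (vperm \<pi>) ds \<in> separating_lists \<tau> r \<longleftrightarrow> (\<forall>d \<in> set ds. twisted_vec \<tau> (vperm \<pi> d))"
    using assms separating_vperm[OF assms(1,4)]
    by (auto simp: separating_lists_def torus_def vperm_prod_3 simp del: vperm_nth)
  then show ?thesis
    using twisted_vec_vperm_iff[of ds \<sigma> \<tau> \<pi>] assms by simp
qed

text \<open>Renumbering by \<pi> stays in the torus of \<sigma> exactly when \<pi> centralizes
  \<sigma>, and different \<pi> give different lists.\<close>

lemma separating_fibre:
  assumes "ds \<in> separating_lists \<sigma> r"
  shows "card {es \<in> separating_lists \<sigma> r. \<exists>\<pi>. \<pi> permutes UNIV \<and> es = map (vperm \<pi>) ds}
    = card {\<pi>. \<pi> permutes UNIV \<and> \<sigma> \<circ> \<pi> = \<pi> \<circ> \<sigma>}"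
proof -
  have ds: "separating ds" "\<forall>d \<in> set ds. twisted_vec \<sigma> d \<and> d $ 1 * d $ 2 * d $ 3 = 1" "length ds = r"
    using assms by (auto simp: separating_lists_def torus_def)
  have "{es \<in> separating_lists \<sigma> r. \<exists>\<pi>. \<pi> permutes UNIV \<and> es = map (vperm \<pi>) ds}
      = (\<lambda>\<pi>. map (vperm \<pi>) ds) ` {\<pi>. \<pi> permutes UNIV \<and> \<sigma> \<circ> \<pi> = \<pi> \<circ> \<sigma>}"
    using separating_lists_vperm_iff[OF ds] by auto
  moreover have "inj_on (\<lambda>\<pi>. map (vperm \<pi>) ds) A" for A
    using separating_vperm_eq_iff[OF ds(1)] by (intro inj_onI) simp
  ultimately show ?thesis
    by (simp add: card_image)
qed

text \<open>Frobenius permutes the rows (1, d_i, d_i^2) as it permutes the entries of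
  \<open>d\<close>, and their determinant is a Vandermonde product.\<close>

lemma vandermonde_twisted:
  assumes "twisted_vec \<sigma> d" "d $ 1 \<noteq> d $ 2" "d $ 1 \<noteq> d $ 3" "d $ 2 \<noteq> d $ 3"
  shows "\<exists>P. invertible P \<and> twisted \<sigma> P"
proof -
  let ?P = "(\<chi> i. vector [1, d $ i, d $ i ^ 2]) :: 'a alg_closure ^ 3 ^ 3"
  have "det ?P = (d $ 2 - d $ 1) * (d $ 3 - d $ 1) * (d $ 3 - d $ 2)"
    by (simp add: det_3) (simp add: algebra_simps power2_eq_square)
  then have "invertible ?P"
    using assms by (simp add: invertible_det_nz)
  moreover have "\<forall>k. frob (?P $ j $ k) = ?P $ \<sigma> j $ k" for j
    using assms(1) unfolding forall_3[of "\<lambda>k. frob (?P $ j $ k) = ?P $ \<sigma> j $ k"]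
    by (simp add: twisted_vec_def frob_power)
  then have "twisted \<sigma> ?P"
    by (simp add: twisted_def)
  ultimately show ?thesis
    by blast
qed

lemma twisted_id_mat_1:
  "invertible (mat 1 :: 'a alg_closure ^ 3 ^ 3) \<and> twisted id (mat 1)"
proof
  show "twisted id (mat 1)"
    by (simp add: twisted_def mat_def)
qed (simp add: invertible_det_nz)

lemma separating_twisted_exists:
  assumes "std_perm \<sigma>" and ds: "ds \<in> separating_lists \<sigma> r"
  shows "\<exists>P. invertible P \<and> twisted \<sigma> P"
proof (cases "\<sigma> = id")
  case True
  then show ?thesis
    using twisted_id_mat_1 by blast
next
  case False
  then have \<sigma>: "\<sigma> = swap12 \<or> \<sigma> = cyc"
    using assms(1) by (simp add: std_perm_def)
  have "(1 :: 3) \<noteq> 2"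
    by simp
  then obtain d where d: "d \<in> set ds" "d $ 1 \<noteq> d $ 2"
    using ds unfolding separating_lists_def separating_def by blast
  then have tw: "\<forall>j. frob (d $ j) = d $ \<sigma> j"
    using ds by (auto simp: separating_lists_def torus_def twisted_vec_def)
  \<comment> \<open>For \<open>swap12\<close>, Frobenius fixes the third entry but moves the first
    two; for \<open>cyc\<close> it carries the inequality of the first two entries around the
    cycle.\<close>
  have "d $ 1 \<noteq> d $ 3 \<and> d $ 2 \<noteq> d $ 3"
    using \<sigma> d(2) tw unfolding forall_3 by (metis cyc_simps swap12_simps frob_eq_iff)
  with d(2) tw show ?thesis
    by (intro vandermonde_twisted) (auto simp: twisted_vec_def)
qed

text \<open>For a separating stratum it remains to show that the Frobenius permutation \<pi> of each
  tuple is conjugate to \<sigma>: renumbering by a conjugating \<rho> brings the eigenvalues into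
  the torus of \<sigma>.\<close>

lemma card_separating_lists:
  assumes \<sigma>: "std_perm \<sigma>" and fin: "finite (torus \<sigma>)"
    and diag: "\<And>Ds. S Ds \<Longrightarrow> diagonal_tuple Ds"
    and S: "\<And>ds. ds \<in> separating_lists \<sigma> r \<Longrightarrow> S (map diagm ds)"
    and normal: "\<And>ds \<pi>. length ds = r \<Longrightarrow> S (map diagm ds) \<Longrightarrow> \<pi> permutes UNIV \<Longrightarrow>
      \<forall>d \<in> set ds. twisted_vec \<pi> d \<Longrightarrow> separating ds \<and> (\<exists>\<rho>. \<rho> permutes UNIV \<and> \<pi> \<circ> \<rho> = \<rho> \<circ> \<sigma>)"
  shows "card (separating_lists \<sigma> r)
    = card {\<pi>. \<pi> permutes UNIV \<and> \<sigma> \<circ> \<pi> = \<pi> \<circ> \<sigma>} * num_closed_orbits r S"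
proof (rule card_eq_mult_num_closed_orbits[OF _ \<sigma> diag _ _ _ _ separating_fibre])
  have "finite {ds. set ds \<subseteq> torus \<sigma> \<and> length ds = r}"
    using fin by (rule finite_lists_length_eq)
  then show "finite (separating_lists \<sigma> r)"
    by (rule rev_finite_subset) (auto simp: separating_lists_def)
  show "length ds = r \<and> set ds \<subseteq> torus \<sigma> \<and> S (map diagm ds)" if "ds \<in> separating_lists \<sigma> r" for ds
    using that S by (auto simp: separating_lists_def)
  show "\<exists>P. invertible P \<and> twisted \<sigma> P" if "ds \<in> separating_lists \<sigma> r" for ds
    using \<sigma> that by (rule separating_twisted_exists)
  show "\<exists>Q. diagonalizes Q (map ac_matrix As) ds \<and> twisted \<sigma> Q"
    if ds: "ds \<in> separating_lists \<sigma> r" "has_eigs As ds" for As ds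
  proof -
    obtain P where "diagonalizes P (map ac_matrix As) ds"
      using ds(2) unfolding has_eigs_def by blast
    then show ?thesis
      using ds(1)
      by (intro twisted_diagonalizer_distinct[OF \<sigma>]) (auto simp: separating_lists_def separating_def torus_def)
  qed
  show "\<exists>\<rho>. \<rho> permutes UNIV \<and> map (vperm \<rho>) ds \<in> separating_lists \<sigma> r"
    if ds: "length ds = r" "S (map diagm ds)" "\<pi> permutes UNIV" "\<forall>d \<in> set ds. twisted_vec \<pi> d" for ds \<pi>
  proof -
    obtain \<rho> where \<rho>: "\<rho> permutes UNIV" "\<pi> \<circ> \<rho> = \<rho> \<circ> \<sigma>" and "separating ds"
      using normal[OF ds] by blast
    moreover have "\<forall>d \<in> set ds. d $ 1 * d $ 2 * d $ 3 = 1"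
      using diag[OF ds(2)] by (simp add: diagonal_tuple_diagm)
    ultimately show ?thesis
      using separating_lists_vperm_iff[of ds \<pi> r \<rho> \<sigma>] ds by blast
  qed
qed auto

end

section \<open>The symmetric group on three letters\<close>

lemma distinct_3_UNIV:
  fixes a b c :: 3
  assumes "a \<noteq> b" "a \<noteq> c" "b \<noteq> c"
  shows "i = a \<or> i = b \<or> i = c"
proof -
  have "card {a, b, c} = CARD(3)"
    using assms by simp
  then have "{a, b, c} = UNIV"
    by (intro card_subset_eq) auto
  then show ?thesis
    by blast
qed

lemma exists_third_index: "\<exists>c. c \<noteq> a \<and> c \<noteq> (b :: 3)"
proof -
  have "card {a, b} \<le> 2"
    by (simp add: card_insert_if)
  then have "{a, b} \<noteq> UNIV"
    by auto
  then show ?thesis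
    by blast
qed

lemma permutes_UNIV_iff_inj: "\<pi> permutes (UNIV :: 'n::finite set) \<longleftrightarrow> inj \<pi>"
proof
  assume "inj \<pi>"
  then have "bij_betw \<pi> UNIV UNIV"
    by (simp add: bij_betw_def finite_UNIV_inj_surj)
  then show "\<pi> permutes UNIV"
    by (rule bij_imp_permutes) simp
qed (rule permutes_inj)

lemma fun_3_eq_iff: "f = g \<longleftrightarrow> f 1 = g 1 \<and> f 2 = g 2 \<and> f (3 :: 3) = g 3"
  by (auto simp: fun_eq_iff forall_3)

lemma derangement_3:
  assumes "inj \<pi>" "\<And>i :: 3. \<pi> i \<noteq> i"
  shows "\<pi> = cyc \<or> \<pi> = cyc \<circ> cyc"
proof -
  have "\<pi> 1 \<noteq> \<pi> 2" "\<pi> 1 \<noteq> \<pi> 3" "\<pi> 2 \<noteq> \<pi> 3"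
    using assms(1) by (simp_all add: inj_eq)
  moreover have "\<pi> 1 \<noteq> 1" "\<pi> 2 \<noteq> 2" "\<pi> 3 \<noteq> 3"
    using assms(2) by blast+
  ultimately show ?thesis
    using exhaust_3[of "\<pi> 1"] exhaust_3[of "\<pi> 2"] exhaust_3[of "\<pi> 3"]
    unfolding fun_3_eq_iff by auto
qed

lemma centralizer_id: "card {\<pi> :: 3 \<Rightarrow> 3. \<pi> permutes UNIV \<and> id \<circ> \<pi> = \<pi> \<circ> id} = 6"
  using card_permutations[of "UNIV :: 3 set" 3] by (simp add: fact_numeral)

text \<open>A permutation commuting with \<open>swap12\<close> must preserve its only fixed point
  3.\<close>

lemma centralizer_swap12: "card {\<pi>. \<pi> permutes UNIV \<and> swap12 \<circ> \<pi> = \<pi> \<circ> swap12} = 2"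
proof -
  have "\<pi> = id \<or> \<pi> = swap12" if "\<pi> permutes UNIV" and comm: "swap12 \<circ> \<pi> = \<pi> \<circ> swap12" for \<pi>
  proof -
    have "inj \<pi>"
      using that(1) by (rule permutes_inj)
    then have "\<pi> 1 \<noteq> \<pi> 2" "\<pi> 1 \<noteq> \<pi> 3" "\<pi> 2 \<noteq> \<pi> 3"
      by (simp_all add: inj_eq)
    moreover have "swap12 (\<pi> 3) = \<pi> 3"
      using comm by (metis comp_apply swap12_simps(3))
    then have "\<pi> 3 = 3"
      using exhaust_3[of "\<pi> 3"] by auto
    ultimately show ?thesis
      using exhaust_3[of "\<pi> 1"] exhaust_3[of "\<pi> 2"] unfolding fun_3_eq_iff by auto
  qed
  then have "{\<pi>. \<pi> permutes UNIV \<and> swap12 \<circ> \<pi> = \<pi> \<circ> swap12} = {id, swap12}"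
    using permutes_swap12 permutes_id by auto
  moreover have "id \<noteq> swap12"
    unfolding fun_3_eq_iff by simp
  ultimately show ?thesis
    by simp
qed

text \<open>In arithmetic modulo 3, \<open>cyc\<close> is translation by 1, and a map commuting with
  it is a translation, determined by its value at 1.\<close>

lemma centralizer_cyc: "card {\<pi>. \<pi> permutes UNIV \<and> cyc \<circ> \<pi> = \<pi> \<circ> cyc} = 3"
proof -
  have "\<pi> = (\<lambda>j. j + (\<pi> 1 - 1))" if comm: "cyc \<circ> \<pi> = \<pi> \<circ> cyc" for \<pi>
  proof -
    have "\<pi> (j + 1) = \<pi> j + 1" for j
      using comm by (metis comp_apply cyc_def)
    from this[of 1] this[of 2] show ?thesis
      unfolding fun_3_eq_iff by (simp add: algebra_simps)
  qed
  moreover have "(\<lambda>j. j + a) permutes (UNIV :: 3 set)" for a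
    by (simp add: permutes_UNIV_iff_inj inj_def)
  moreover have "cyc \<circ> (\<lambda>j. j + a) = (\<lambda>j. j + a) \<circ> cyc" for a
    by (simp add: fun_eq_iff cyc_def algebra_simps)
  ultimately have "{\<pi>. \<pi> permutes UNIV \<and> cyc \<circ> \<pi> = \<pi> \<circ> cyc} = range (\<lambda>a j. j + a)"
    by blast
  moreover have "inj (\<lambda>a j. j + a :: 3)"
    by (auto simp: inj_def fun_eq_iff)
  ultimately show ?thesis
    by (simp add: card_image)
qed

lemma scalar_matrix_diagm: "scalar_matrix (diagm d) \<longleftrightarrow> (\<forall>i j. d $ i = d $ j)"
  by (simp add: scalar_matrix_def)

text \<open>For the central and repeating strata, where the normal form is unique and classes have
  size 1.\<close>

lemma vperm_singleton_fibre:
  assumes "ds \<in> A"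
    and "\<And>\<pi>. \<pi> permutes UNIV \<Longrightarrow> map (vperm \<pi>) ds \<in> A \<Longrightarrow> map (vperm \<pi>) ds = ds"
  shows "card {es \<in> A. \<exists>\<pi>. \<pi> permutes UNIV \<and> es = map (vperm \<pi>) ds} = 1"
proof -
  have "map (vperm id) ds = ds"
    by (intro map_idI) (auto simp: vec_eq_iff)
  then have "\<exists>\<pi>. \<pi> permutes UNIV \<and> ds = map (vperm \<pi>) ds"
    using permutes_id by metis
  with assms have "{es \<in> A. \<exists>\<pi>. \<pi> permutes UNIV \<and> es = map (vperm \<pi>) ds} = {ds}"
    by blast
  then show ?thesis
    by simp
qed

section \<open>Normal forms in the five strata\<close>

context finite_field_closure
begin

lemma central_tuple_iff:
  "central_tuple (map diagm ds) \<longleftrightarrow>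
    (\<forall>d \<in> set ds. d \<in> torus id \<and> (\<forall>i j. d $ i = d $ j))"
  by (auto simp: central_tuple_def diagonal_tuple_diagm scalar_matrix_diagm base_field_iff
      torus_def twisted_vec_def)

lemma repeating_tuple_iff:
  "repeating_tuple (map diagm ds) \<longleftrightarrow> set ds \<subseteq> torus id \<and>
    \<not> (\<forall>d \<in> set ds. \<forall>i j. d $ i = d $ j) \<and> (\<exists>s t. s \<noteq> t \<and> (\<forall>d \<in> set ds. d $ s = d $ t))"
  by (auto simp: repeating_tuple_def diagonal_tuple_diagm scalar_matrix_diagm base_field_iff
      torus_def twisted_vec_def)

text \<open>A rational diagonal tuple on which two characters coincide is central if all members are
  scalar and repeating otherwise; what is left is the separating tuples.\<close>

lemma reducible_tuple_iff:
  "reducible_tuple (map diagm ds) \<longleftrightarrow> set ds \<subseteq> torus id \<and> separating ds"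
proof -
  have "(1 :: 3) \<noteq> 2"
    by simp
  then have *: "separating ds \<Longrightarrow> \<not> (\<forall>d \<in> set ds. \<forall>i j. d $ i = d $ j)"
    unfolding separating_def by blast
  have sep: "separating ds \<longleftrightarrow> \<not> (\<exists>s t. s \<noteq> t \<and> (\<forall>d \<in> set ds. d $ s = d $ t))"
    by (auto simp: separating_def)
  have "reducible_tuple (map diagm ds) \<longleftrightarrow> set ds \<subseteq> torus id \<and>
      \<not> central_tuple (map diagm ds) \<and> \<not> repeating_tuple (map diagm ds)"
    by (auto simp: reducible_tuple_def diagonal_tuple_diagm base_field_iff torus_def twisted_vec_def)
  moreover have "central_tuple (map diagm ds) \<longleftrightarrow> (\<forall>d \<in> set ds. \<forall>i j. d $ i = d $ j)"
    if "set ds \<subseteq> torus id"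
    using that unfolding central_tuple_iff by blast
  ultimately show ?thesis
    using * unfolding repeating_tuple_iff sep by argo
qed

lemma irreducible_tuple_iff:
  "irreducible_tuple (map diagm ds) \<longleftrightarrow> (\<forall>d \<in> set ds. d $ 1 * d $ 2 * d $ 3 = 1) \<and>
    (\<exists>d \<in> set ds. \<forall>i. frob (d $ i) \<noteq> d $ i)"
  by (simp add: irreducible_tuple_def diagonal_tuple_diagm base_field_iff)

lemma partially_reducible_tuple_iff:
  "partially_reducible_tuple (map diagm ds) \<longleftrightarrow> (\<forall>d \<in> set ds. d $ 1 * d $ 2 * d $ 3 = 1) \<and>
    (\<exists>d \<in> set ds. card {i. frob (d $ i) \<noteq> d $ i} = 2)"
  by (simp add: partially_reducible_tuple_def diagonal_tuple_diagm base_field_iff)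

lemma card_reducible:
  assumes "finite (torus id)"
  shows "card (separating_lists id r) =
    6 * num_closed_orbits r (reducible_tuple :: ('a alg_closure ^ 3 ^ 3) list \<Rightarrow> bool)"
  unfolding centralizer_id[symmetric]
proof (rule card_separating_lists)
  show "reducible_tuple (map diagm ds)" if "ds \<in> separating_lists id r" for ds
    using that by (simp add: reducible_tuple_iff separating_lists_def)
  fix ds :: "('a alg_closure ^ 3) list" and \<pi> :: "3 \<Rightarrow> 3"
  assume red: "reducible_tuple (map diagm ds)" and tw: "\<forall>d \<in> set ds. twisted_vec \<pi> d"
  then have "separating ds" "\<forall>d \<in> set ds. twisted_vec id d"
    by (auto simp: reducible_tuple_iff torus_def)
  with tw have "\<pi> = id"
    unfolding separating_def twisted_vec_def fun_eq_iff id_apply by metis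
  with \<open>separating ds\<close> show "separating ds \<and> (\<exists>\<rho>. \<rho> permutes UNIV \<and> \<pi> \<circ> \<rho> = \<rho> \<circ> id)"
    using permutes_id[of "UNIV :: 3 set"] by blast
qed (use assms in \<open>auto simp: std_perm_def reducible_tuple_def\<close>)

text \<open>A member without entries in F_q is moved by Frobenius in every position, so \<pi> has no
  fixed point and is a 3-cycle.\<close>

lemma card_irreducible:
  assumes "finite (torus cyc)"
  shows "card (separating_lists cyc r) =
    3 * num_closed_orbits r (irreducible_tuple :: ('a alg_closure ^ 3 ^ 3) list \<Rightarrow> bool)"
  unfolding centralizer_cyc[symmetric]
proof (rule card_separating_lists)
  fix ds :: "('a alg_closure ^ 3) list"
  assume ds: "ds \<in> separating_lists cyc r"
  have "(1 :: 3) \<noteq> 2"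
    by simp
  then obtain d where d: "d \<in> set ds" "d $ 1 \<noteq> d $ 2"
    using ds unfolding separating_lists_def separating_def by blast
  then have "frob (d $ 1) = d $ 2" "frob (d $ 2) = d $ 3" "frob (d $ 3) = d $ 1"
    using ds by (auto simp: separating_lists_def torus_def twisted_vec_def)
  with d(2) have "\<forall>i. frob (d $ i) \<noteq> d $ i"
    unfolding forall_3 by (metis frob_eq_iff)
  with d(1) ds show "irreducible_tuple (map diagm ds)"
    by (auto simp: irreducible_tuple_iff separating_lists_def torus_def)
next
  fix ds :: "('a alg_closure ^ 3) list" and \<pi> :: "3 \<Rightarrow> 3"
  assume irr: "irreducible_tuple (map diagm ds)" and tw: "\<forall>d \<in> set ds. twisted_vec \<pi> d"
    and perm: "\<pi> permutes UNIV"
  obtain d where d: "d \<in> set ds" "\<And>i. frob (d $ i) \<noteq> d $ i"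
    using irr by (auto simp: irreducible_tuple_iff)
  then have neq: "d $ \<pi> i \<noteq> d $ i" for i
    using tw by (metis twisted_vec_def)
  then have "\<pi> i \<noteq> i" for i
    by metis
  then have \<pi>: "\<pi> = cyc \<or> \<pi> = cyc \<circ> cyc"
    using permutes_inj[OF perm] by (rule derangement_3[rotated])
  then have "d $ 1 \<noteq> d $ 2 \<and> d $ 1 \<noteq> d $ 3 \<and> d $ 2 \<noteq> d $ 3"
    using neq[of 1] neq[of 2] neq[of 3] by auto
  then have "\<forall>i j. i \<noteq> j \<longrightarrow> d $ i \<noteq> d $ j"
    unfolding forall_3 by auto
  then have "separating ds"
    using d(1) unfolding separating_def by blast
  \<comment> \<open>The two 3-cycles are conjugate by \<open>swap12\<close>.\<close>
  moreover have "\<pi> \<circ> id = id \<circ> cyc \<or> \<pi> \<circ> swap12 = swap12 \<circ> cyc"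
    using \<pi> unfolding fun_3_eq_iff by auto
  ultimately show "separating ds \<and> (\<exists>\<rho>. \<rho> permutes UNIV \<and> \<pi> \<circ> \<rho> = \<rho> \<circ> cyc)"
    using permutes_id permutes_swap12 by blast
qed (use assms in \<open>auto simp: std_perm_def irreducible_tuple_def\<close>)

lemma card_partially_reducible:
  assumes "finite (torus swap12)"
  shows "card (separating_lists swap12 r) =
    2 * num_closed_orbits r (partially_reducible_tuple :: ('a alg_closure ^ 3 ^ 3) list \<Rightarrow> bool)"
  unfolding centralizer_swap12[symmetric]
proof (rule card_separating_lists)
  fix ds :: "('a alg_closure ^ 3) list"
  assume ds: "ds \<in> separating_lists swap12 r"
  have "(1 :: 3) \<noteq> 2"
    by simp
  then obtain d where d: "d \<in> set ds" "d $ 1 \<noteq> d $ 2"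
    using ds unfolding separating_lists_def separating_def by blast
  then have "frob (d $ 1) = d $ 2" "frob (d $ 2) = d $ 1" "frob (d $ 3) = d $ 3"
    using ds by (auto simp: separating_lists_def torus_def twisted_vec_def)
  with d(2) have "\<forall>i. frob (d $ i) \<noteq> d $ i \<longleftrightarrow> i \<in> {1, 2}"
    unfolding forall_3 by auto
  then have "{i. frob (d $ i) \<noteq> d $ i} = {1, 2}"
    by blast
  then have "card {i. frob (d $ i) \<noteq> d $ i} = 2"
    by simp
  with d(1) ds show "partially_reducible_tuple (map diagm ds)"
    by (auto simp: partially_reducible_tuple_iff separating_lists_def torus_def)
next
  fix ds :: "('a alg_closure ^ 3) list" and \<pi> :: "3 \<Rightarrow> 3"
  assume part: "partially_reducible_tuple (map diagm ds)" and tw: "\<forall>d \<in> set ds. twisted_vec \<pi> d"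
    and perm: "\<pi> permutes UNIV"
  obtain d where d: "d \<in> set ds" "card {i. frob (d $ i) \<noteq> d $ i} = 2"
    using part by (auto simp: partially_reducible_tuple_iff)
  have frob_d: "frob (d $ i) = d $ \<pi> i" for i
    using tw d(1) by (simp add: twisted_vec_def)
  obtain a b where ab: "a \<noteq> b" "{i. frob (d $ i) \<noteq> d $ i} = {a, b}"
    using d(2) by (auto simp: card_2_iff)
  have "\<exists>c. c \<noteq> a \<and> c \<noteq> b"
    by (rule exists_third_index)
  then obtain c where c: "c \<noteq> a" "c \<noteq> b"
    by blast
  have nonfixed: "frob (d $ i) \<noteq> d $ i \<longleftrightarrow> i = a \<or> i = b" for i
    using ab(2) by blast
  then have ne: "d $ \<pi> a \<noteq> d $ a" "d $ \<pi> b \<noteq> d $ b" "d $ \<pi> c = d $ c"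
    using c frob_d by auto
  \<comment> \<open>Position \<open>c\<close> carries the only rational entry of \<open>d\<close>,
    and its image under \<pi> carries a rational entry too; so \<pi> fixes \<open>c\<close> and,
    moving the other two entries, swaps \<open>a\<close> and \<open>b\<close>.\<close>
  have "frob (d $ \<pi> c) = d $ \<pi> c"
    unfolding ne(3) using nonfixed c by blast
  then have \<pi>c: "\<pi> c = c"
    using nonfixed c distinct_3_UNIV[OF ab(1), of c "\<pi> c"] by blast
  have "\<pi> a \<noteq> c" "\<pi> b \<noteq> c"
    using permutes_inj[OF perm] \<pi>c c by (metis injD)+
  then have \<pi>ab: "\<pi> a = b" "\<pi> b = a"
    using ne distinct_3_UNIV[OF ab(1) c[symmetric], of "\<pi> a"] distinct_3_UNIV[OF ab(1) c[symmetric], of "\<pi> b"]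
    by metis+
  have "d $ a \<noteq> d $ b"
    using ne \<pi>ab by simp
  moreover have "d $ a \<noteq> d $ c" "d $ b \<noteq> d $ c"
    using nonfixed c by metis+
  ultimately have "d $ i \<noteq> d $ j" if "i \<noteq> j" for i j
    using distinct_3_UNIV[OF ab(1) c[symmetric], of i] distinct_3_UNIV[OF ab(1) c[symmetric], of j] that
    by auto
  then have "separating ds"
    using d(1) unfolding separating_def by blast
  \<comment> \<open>This \<rho> sends 1, 2, 3 to \<open>a\<close>, \<open>b\<close>,
    \<open>c\<close> and thereby conjugates \<open>swap12\<close> into \<pi>.\<close>
  moreover define \<rho> where "\<rho> i = (if i = 1 then a else if i = 2 then b else c)" for i :: 3
  have \<rho>: "\<rho> 1 = a" "\<rho> 2 = b" "\<rho> 3 = c"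
    by (simp_all add: \<rho>_def)
  have "\<forall>i j. \<rho> i = \<rho> j \<longrightarrow> i = j"
    unfolding forall_3 \<rho> using ab(1) c by auto
  then have "\<rho> permutes UNIV"
    by (simp add: permutes_UNIV_iff_inj inj_def)
  moreover have "\<pi> \<circ> \<rho> = \<rho> \<circ> swap12"
    unfolding fun_3_eq_iff by (simp add: \<rho> \<pi>ab \<pi>c)
  ultimately show "separating ds \<and> (\<exists>\<rho>. \<rho> permutes UNIV \<and> \<pi> \<circ> \<rho> = \<rho> \<circ> swap12)"
    by blast
qed (use assms in \<open>auto simp: std_perm_def partially_reducible_tuple_def\<close>)

definition center :: "('a alg_closure ^ 3) set" where
  "center = {d \<in> torus id. d $ 1 = d $ 2 \<and> d $ 2 = d $ 3}"

text \<open>The kernel of the root d_s / d_t on the split torus.\<close>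

definition wall :: "3 \<Rightarrow> 3 \<Rightarrow> ('a alg_closure ^ 3) set" where
  "wall s t = {d \<in> torus id. d $ s = d $ t}"

abbreviation lists_over :: "('a alg_closure ^ 3) set \<Rightarrow> nat \<Rightarrow> ('a alg_closure ^ 3) list set" where
  "lists_over A r \<equiv> {ds. set ds \<subseteq> A \<and> length ds = r}"

lemma center_iff: "d \<in> center \<longleftrightarrow> d \<in> torus id \<and> (\<forall>i j. d $ i = d $ j)"
  unfolding center_def forall_3 by auto

lemma card_central:
  assumes "finite center"
  shows "card (lists_over center r) =
    num_closed_orbits r (central_tuple :: ('a alg_closure ^ 3 ^ 3) list \<Rightarrow> bool)"
proof -
  have "card (lists_over center r) =
    1 * num_closed_orbits r (central_tuple :: ('a alg_closure ^ 3 ^ 3) list \<Rightarrow> bool)"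
  proof (rule card_eq_mult_num_closed_orbits[where \<sigma> = id])
    fix ds assume ds: "ds \<in> lists_over center r"
    then have scalar: "d $ i = d $ j" if "d \<in> set ds" for d i j
      using that by (auto simp: center_iff)
    show "length ds = r \<and> set ds \<subseteq> torus id \<and> central_tuple (map diagm ds)"
      using ds by (auto simp: central_tuple_iff center_iff)
    show "\<exists>P. invertible P \<and> twisted id P"
      using twisted_id_mat_1 by blast
    show "\<exists>Q. diagonalizes Q (map ac_matrix As) ds \<and> twisted id Q" if "has_eigs As ds" for As
      using that twisted_diagonalizer_scalar scalar unfolding has_eigs_def by blast
    show "card {es \<in> lists_over center r. \<exists>\<pi>. \<pi> permutes UNIV \<and> es = map (vperm \<pi>) ds} = 1"
      using ds scalar by (intro vperm_singleton_fibre map_idI) (auto simp: vec_eq_iff)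
  next
    fix ds :: "('a alg_closure ^ 3) list" and \<pi> :: "3 \<Rightarrow> 3"
    assume ds: "length ds = r" "central_tuple (map diagm ds)"
    have "map (vperm id) ds = ds"
      by (intro map_idI) (auto simp: vec_eq_iff)
    then show "\<exists>\<rho>. \<rho> permutes UNIV \<and> map (vperm \<rho>) ds \<in> lists_over center r"
      using ds permutes_id by (intro exI[of _ id]) (auto simp: central_tuple_iff center_iff)
  qed (use assms in \<open>auto simp: std_perm_def central_tuple_def finite_lists_length_eq\<close>)
  then show ?thesis
    by simp
qed

lemma vperm_torus_id: "d \<in> torus id \<Longrightarrow> \<pi> permutes UNIV \<Longrightarrow> vperm \<pi> d \<in> torus id"
  using vperm_prod_3[of \<pi> d] by (simp add: torus_def twisted_vec_def)

text \<open>The normal form puts the repeated character in positions 1 and 2. The renumberings that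
  respect it are the identity and \<open>swap12\<close>, neither of which changes the list.\<close>

lemma card_repeating:
  assumes fin: "finite (wall 1 2)"
  shows "card (lists_over (wall 1 2) r - lists_over center r) =
    num_closed_orbits r (repeating_tuple :: ('a alg_closure ^ 3 ^ 3) list \<Rightarrow> bool)"
proof -
  let ?Y = "lists_over (wall 1 2) r - lists_over center r"
  have Y_iff: "ds \<in> ?Y \<longleftrightarrow> length ds = r \<and> set ds \<subseteq> torus id \<and> (\<forall>d \<in> set ds. d $ 1 = d $ 2) \<and>
      (\<exists>d \<in> set ds. d $ 1 \<noteq> d $ 3)" for ds
    unfolding wall_def center_def by (auto simp: subset_iff; metis)
  have "card ?Y = 1 * num_closed_orbits r (repeating_tuple :: ('a alg_closure ^ 3 ^ 3) list \<Rightarrow> bool)"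
  proof (rule card_eq_mult_num_closed_orbits[where \<sigma> = id])
    fix ds assume "ds \<in> ?Y"
    then have ds: "length ds = r" "set ds \<subseteq> torus id" and rep: "\<And>d. d \<in> set ds \<Longrightarrow> d $ 1 = d $ 2"
      and "\<exists>d \<in> set ds. d $ 1 \<noteq> d $ 3"
      unfolding Y_iff by auto
    then obtain d0 where d0: "d0 \<in> set ds" "d0 $ 1 \<noteq> d0 $ 3"
      by blast
    have "(1 :: 3) \<noteq> 2"
      by simp
    with d0 rep have "repeating_tuple (map diagm ds)"
      unfolding repeating_tuple_iff using ds(2) by metis
    with ds show "length ds = r \<and> set ds \<subseteq> torus id \<and> repeating_tuple (map diagm ds)"
      by simp
    show "\<exists>P. invertible P \<and> twisted id P"
      using twisted_id_mat_1 by blast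
    show "\<exists>Q. diagonalizes Q (map ac_matrix As) ds \<and> twisted id Q" if eigs: "has_eigs As ds" for As
    proof -
      obtain P where "diagonalizes P (map ac_matrix As) ds"
        using eigs unfolding has_eigs_def by blast
      then show ?thesis
        using ds(2) by (intro twisted_diagonalizer_repeating[OF _ _ rep d0]) (auto simp: torus_def)
    qed
    show "card {es \<in> ?Y. \<exists>\<pi>. \<pi> permutes UNIV \<and> es = map (vperm \<pi>) ds} = 1"
      using \<open>ds \<in> ?Y\<close>
    proof (rule vperm_singleton_fibre)
      fix \<pi> :: "3 \<Rightarrow> 3"
      assume perm: "\<pi> permutes UNIV" and mem: "map (vperm \<pi>) ds \<in> ?Y"
      have "\<pi> 1 \<noteq> \<pi> 2" "\<pi> 1 \<noteq> \<pi> 3" "\<pi> 2 \<noteq> \<pi> 3"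
        using permutes_inj[OF perm] by (simp_all add: inj_eq)
      moreover have "\<forall>d \<in> set ds. d $ \<pi> 1 = d $ \<pi> 2"
        using mem unfolding Y_iff by simp
      then have "d0 $ \<pi> 1 = d0 $ \<pi> 2"
        using d0(1) by blast
      \<comment> \<open>The third entry of \<open>d0\<close> differs from the common value of the
        first two, so the positions \<pi> 1 and \<pi> 2, where \<open>d0\<close> agrees, are 1 and
        2.\<close>
      ultimately have "\<pi> 3 = 3 \<and> (\<pi> 1 = 1 \<and> \<pi> 2 = 2 \<or> \<pi> 1 = 2 \<and> \<pi> 2 = 1)"
        using exhaust_3[of "\<pi> 1"] exhaust_3[of "\<pi> 2"] exhaust_3[of "\<pi> 3"] d0(2) rep[OF d0(1)]
        by auto
      then have "vperm \<pi> d = d" if "d \<in> set ds" for d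
        using rep[OF that] unfolding vec_eq_iff forall_3 by auto
      then show "map (vperm \<pi>) ds = ds"
        by (simp add: map_idI)
    qed
  next
    fix ds :: "('a alg_closure ^ 3) list" and \<pi> :: "3 \<Rightarrow> 3"
    assume len: "length ds = r" and rep: "repeating_tuple (map diagm ds)"
    then obtain s t where st: "s \<noteq> t" "\<And>d. d \<in> set ds \<Longrightarrow> d $ s = d $ t"
      by (auto simp: repeating_tuple_iff)
    have "\<exists>c. c \<noteq> s \<and> c \<noteq> t"
      by (rule exists_third_index)
    then obtain c where c: "c \<noteq> s" "c \<noteq> t"
      by blast
    obtain d0 i j where d0: "d0 \<in> set ds" "d0 $ i \<noteq> d0 $ j"
      using rep by (auto simp: repeating_tuple_iff)
    then have "d0 $ s \<noteq> d0 $ c"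
      using distinct_3_UNIV[OF st(1) c[symmetric], of i] distinct_3_UNIV[OF st(1) c[symmetric], of j]
        st(2)[OF d0(1)]
      by auto
    define \<rho> where "\<rho> i = (if i = 1 then s else if i = 2 then t else c)" for i :: 3
    have \<rho>: "\<rho> 1 = s" "\<rho> 2 = t" "\<rho> 3 = c"
      by (simp_all add: \<rho>_def)
    have "\<forall>i j. \<rho> i = \<rho> j \<longrightarrow> i = j"
      unfolding forall_3 \<rho> using st(1) c by auto
    then have perm: "\<rho> permutes UNIV"
      by (simp add: permutes_UNIV_iff_inj inj_def)
    have "set (map (vperm \<rho>) ds) \<subseteq> torus id"
      using rep vperm_torus_id[OF _ perm] by (auto simp: repeating_tuple_iff simp del: vperm_nth)
    moreover have "\<forall>d \<in> set (map (vperm \<rho>) ds). d $ 1 = d $ 2"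
      using st(2) by (simp add: \<rho>)
    moreover have "\<exists>d \<in> set (map (vperm \<rho>) ds). d $ 1 \<noteq> d $ 3"
      using d0(1) \<open>d0 $ s \<noteq> d0 $ c\<close> by (auto simp: \<rho>)
    ultimately have "map (vperm \<rho>) ds \<in> ?Y"
      unfolding Y_iff using len by simp
    with perm show "\<exists>\<rho>. \<rho> permutes UNIV \<and> map (vperm \<rho>) ds \<in> ?Y"
      by blast
  qed (use fin in \<open>auto simp: std_perm_def repeating_tuple_def finite_lists_length_eq\<close>)
  then show ?thesis
    by simp
qed


section \<open>Orders of the tori, the walls and the centre\<close>

lemma finite_roots_of_unity: "n > 0 \<Longrightarrow> finite {x :: 'a alg_closure. x ^ n = 1}"
proof -
  assume n: "n > 0"
  then have "Polynomial.coeff (Polynomial.monom 1 n - 1 :: 'a alg_closure poly) n = 1"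
    by (simp add: coeff_1)
  then have "Polynomial.monom 1 n - 1 \<noteq> (0 :: 'a alg_closure poly)"
    by (metis Polynomial.coeff_0 zero_neq_one)
  then have "finite {x. poly (Polynomial.monom 1 n - 1 :: 'a alg_closure poly) x = 0}"
    by (rule poly_roots_finite)
  then show ?thesis
    by (simp add: poly_monom)
qed

lemma card_roots_of_unity:
  assumes "int q dvd int n - 1 \<or> int q dvd int n + 1"
  shows "card {x :: 'a alg_closure. x ^ n = 1} = n"
proof (rule card_roots_of_unity_alg_closed, rule of_nat_neq_0_mod_q)
  show "[int n = 1] (mod int q) \<or> [int n = - 1] (mod int q)"
    using assms by (simp add: cong_iff_dvd_diff)
qed

lemma frob_fixed_iff: "frob x = x \<longleftrightarrow> x = 0 \<or> x ^ (q - 1) = 1"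
proof -
  have "x ^ q = x * x ^ (q - 1)"
    using q_gt_1 power_minus_mult[of q x] by (simp add: mult.commute)
  then show ?thesis
    using q_gt_1 by (auto simp: frob_def)
qed

lemma torus_nth_3: "d \<in> torus \<sigma> \<Longrightarrow> inverse (d $ 1 * d $ 2) = d $ 3"
  by (rule inverse_unique) (simp add: torus_def)

abbreviation unit_roots :: "nat \<Rightarrow> 'a alg_closure set" where
  "unit_roots n \<equiv> {x. x ^ n = 1}"

lemma card_unit_roots:
  shows "card (unit_roots (q - 1)) = q - 1" "finite (unit_roots (q - 1))"
    and "card (unit_roots (q ^ 2 - 1)) = q ^ 2 - 1" "finite (unit_roots (q ^ 2 - 1))"
    and "card (unit_roots (q ^ 2 + q + 1)) = q ^ 2 + q + 1" "finite (unit_roots (q ^ 2 + q + 1))"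
proof -
  have q2: "q ^ 2 > 1"
    using q_gt_1 by (rule one_less_power) simp
  show "card (unit_roots (q - 1)) = q - 1"
    using q_gt_1 by (intro card_roots_of_unity) (simp add: of_nat_diff)
  show "card (unit_roots (q ^ 2 - 1)) = q ^ 2 - 1"
    using q2 by (intro card_roots_of_unity) (simp add: of_nat_diff)
  have "int (q ^ 2 + q + 1) - 1 = int q * (int q + 1)"
    by (simp add: algebra_simps power2_eq_square)
  then show "card (unit_roots (q ^ 2 + q + 1)) = q ^ 2 + q + 1"
    by (intro card_roots_of_unity) (metis dvd_triv_left)
  show "finite (unit_roots (q - 1))" "finite (unit_roots (q ^ 2 - 1))"
    "finite (unit_roots (q ^ 2 + q + 1))"
    using q_gt_1 q2 by (intro finite_roots_of_unity; simp)+
qed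

lemma unit_roots_iff: "x \<in> unit_roots (q - 1) \<longleftrightarrow> x \<noteq> 0 \<and> frob x = x"
  using q_gt_1 by (auto simp: frob_fixed_iff power_0_left)

lemma torus_id_bij:
  "bij_betw (\<lambda>d. (d $ 1, d $ 2)) (torus id) (unit_roots (q - 1) \<times> unit_roots (q - 1))"
proof (rule bij_betw_byWitness[where f' = "\<lambda>(x, y). vector [x, y, inverse (x * y)]"])
  show "\<forall>d \<in> torus id. (case (d $ 1, d $ 2) of (x, y) \<Rightarrow> vector [x, y, inverse (x * y)]) = d"
    by (simp add: vec_eq_iff forall_3 torus_nth_3 del: inverse_mult_distrib)
  show "(\<lambda>d. (d $ 1, d $ 2)) ` torus id \<subseteq> unit_roots (q - 1) \<times> unit_roots (q - 1)"
    unfolding image_subset_iff mem_Times_iff unit_roots_iff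
    by (auto simp: torus_def twisted_vec_def)
  have "vector [x, y, inverse (x * y)] \<in> torus id"
    if "x \<in> unit_roots (q - 1)" "y \<in> unit_roots (q - 1)" for x y
    using that unfolding unit_roots_iff
    by (simp add: torus_def twisted_vec_def forall_3 frob_simps del: inverse_mult_distrib)
  then show "(\<lambda>(x, y). vector [x, y, inverse (x * y)]) ` (unit_roots (q - 1) \<times> unit_roots (q - 1)) \<subseteq> torus id"
    by auto
qed auto

text \<open>A point is (x, x^q, x^(-1-q)) with \<open>x\<close> any nonzero element of F_(q^2); the
  last entry is the inverse of a norm and hence rational.\<close>

lemma torus_swap12_bij: "bij_betw (\<lambda>d. d $ 1) (torus swap12) (unit_roots (q ^ 2 - 1))"
proof (rule bij_betw_byWitness[where f' = "\<lambda>x. vector [x, frob x, inverse (x * frob x)]"])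
  have roots: "x \<in> unit_roots (q ^ 2 - 1) \<longleftrightarrow> x \<noteq> 0 \<and> frob (frob x) = x" for x
  proof -
    have q2: "q ^ 2 > 1"
      using q_gt_1 by (rule one_less_power) simp
    have "frob (frob x) = x ^ q ^ 2"
      by (simp add: frob_def power2_eq_square power_mult)
    also have "\<dots> = x * x ^ (q ^ 2 - 1)"
      using q_gt_1 power_minus_mult[of "q ^ 2" x] by (simp add: mult.commute)
    finally show ?thesis
      using q2 by (auto simp: power_0_left)
  qed
  show "\<forall>d \<in> torus swap12. vector [d $ 1, frob (d $ 1), inverse (d $ 1 * frob (d $ 1))] = d"
  proof
    fix d assume d: "d \<in> torus swap12"
    then have "frob (d $ 1) = d $ 2"
      by (simp add: torus_def twisted_vec_def)
    with torus_nth_3[OF d] show "vector [d $ 1, frob (d $ 1), inverse (d $ 1 * frob (d $ 1))] = d"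
      by (simp add: vec_eq_iff forall_3 del: inverse_mult_distrib)
  qed
  show "(\<lambda>d. d $ 1) ` torus swap12 \<subseteq> unit_roots (q ^ 2 - 1)"
    unfolding image_subset_iff roots by (auto simp: torus_def twisted_vec_def)
  have "vector [x, frob x, inverse (x * frob x)] \<in> torus swap12"
    if "x \<in> unit_roots (q ^ 2 - 1)" for x
    using that unfolding roots
    by (simp add: torus_def twisted_vec_def forall_3 frob_simps mult.commute del: inverse_mult_distrib)
  then show "(\<lambda>x. vector [x, frob x, inverse (x * frob x)]) ` unit_roots (q ^ 2 - 1) \<subseteq> torus swap12"
    by auto
qed auto

lemma torus_cyc_bij: "bij_betw (\<lambda>d. d $ 1) (torus cyc) (unit_roots (q ^ 2 + q + 1))"
proof (rule bij_betw_byWitness[where f' = "\<lambda>x. vector [x, frob x, frob (frob x)]"])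
  have roots: "x ^ (q ^ 2 + q + 1) = x * frob x * frob (frob x)" for x
    by (simp add: frob_def power_add power2_eq_square power_mult)
  show "\<forall>d \<in> torus cyc. vector [d $ 1, frob (d $ 1), frob (frob (d $ 1))] = d"
    by (auto simp: vec_eq_iff forall_3 torus_def twisted_vec_def)
  show "(\<lambda>d. d $ 1) ` torus cyc \<subseteq> unit_roots (q ^ 2 + q + 1)"
    unfolding image_subset_iff mem_Collect_eq roots by (auto simp: torus_def twisted_vec_def)
  have "vector [x, frob x, frob (frob x)] \<in> torus cyc"
    if x: "x \<in> unit_roots (q ^ 2 + q + 1)" for x
  proof -
    have norm: "x * frob x * frob (frob x) = 1"
      using x unfolding mem_Collect_eq roots .
    then have "frob (x * frob x * frob (frob x)) = x * frob x * frob (frob x)"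
      by simp
    moreover have "x \<noteq> 0"
      using norm by auto
    \<comment> \<open>Norm 1 is preserved by Frobenius, so membership of \<open>x\<close> in F_(q^3)
      follows from the norm equation.\<close>
    ultimately have "frob (frob (frob x)) = x"
      by (simp add: frob_mult)
    with norm show ?thesis
      by (simp add: torus_def twisted_vec_def forall_3)
  qed
  then show "(\<lambda>x. vector [x, frob x, frob (frob x)]) ` unit_roots (q ^ 2 + q + 1) \<subseteq> torus cyc"
    by auto
qed auto

lemma wall_12_bij: "bij_betw (\<lambda>d. d $ 1) (wall 1 2) (unit_roots (q - 1))"
proof (rule bij_betw_byWitness[where f' = "\<lambda>x. vector [x, x, inverse (x * x)]"])
  show "\<forall>d \<in> wall 1 2. vector [d $ 1, d $ 1, inverse (d $ 1 * d $ 1)] = d"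
  proof
    fix d assume "d \<in> wall 1 2"
    then have d: "d \<in> torus id" "d $ 2 = d $ 1"
      by (auto simp: wall_def)
    then show "vector [d $ 1, d $ 1, inverse (d $ 1 * d $ 1)] = d"
      using torus_nth_3[OF d(1)] by (simp add: vec_eq_iff forall_3 del: inverse_mult_distrib)
  qed
  show "(\<lambda>d. d $ 1) ` wall 1 2 \<subseteq> unit_roots (q - 1)"
    unfolding image_subset_iff unit_roots_iff by (auto simp: wall_def torus_def twisted_vec_def)
  have "vector [x, x, inverse (x * x)] \<in> wall 1 2" if "x \<in> unit_roots (q - 1)" for x
    using that unfolding unit_roots_iff
    by (simp add: wall_def torus_def twisted_vec_def forall_3 frob_simps del: inverse_mult_distrib)
  then show "(\<lambda>x. vector [x, x, inverse (x * x)]) ` unit_roots (q - 1) \<subseteq> wall 1 2"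
    by auto
qed auto

lemma center_bij: "bij_betw (\<lambda>d. d $ 1) center {x. x ^ 3 = 1 \<and> frob x = x}"
proof (rule bij_betw_byWitness[where f' = "\<lambda>x. vector [x, x, x]"])
  show "\<forall>d \<in> center. vector [d $ 1, d $ 1, d $ 1] = d"
    by (auto simp: vec_eq_iff forall_3 center_def)
  show "(\<lambda>d. d $ 1) ` center \<subseteq> {x. x ^ 3 = 1 \<and> frob x = x}"
    by (auto simp: center_def torus_def twisted_vec_def power3_eq_cube)
  show "(\<lambda>x. vector [x, x, x]) ` {x. x ^ 3 = 1 \<and> frob x = x} \<subseteq> center"
    by (auto simp: center_def torus_def twisted_vec_def forall_3 power3_eq_cube)
qed auto

text \<open>Renumbering the diagonal is an automorphism of the split torus, so all three walls have
  the order of \<open>wall 1 2\<close>.\<close>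

lemma wall_vperm:
  assumes "\<pi> permutes UNIV"
  shows "bij_betw (vperm \<pi>) (wall (\<pi> s) (\<pi> t)) (wall s t)"
proof (rule bij_betw_byWitness[where f' = "vperm (Hilbert_Choice.inv \<pi>)"])
  have inv: "Hilbert_Choice.inv \<pi> permutes UNIV"
    using assms by (rule permutes_inv)
  show "\<forall>d \<in> wall (\<pi> s) (\<pi> t). vperm (Hilbert_Choice.inv \<pi>) (vperm \<pi> d) = d"
    "\<forall>d \<in> wall s t. vperm \<pi> (vperm (Hilbert_Choice.inv \<pi>) d) = d"
    using assms by (simp_all add: vec_eq_iff permutes_inverses)
  show "vperm \<pi> ` wall (\<pi> s) (\<pi> t) \<subseteq> wall s t"
    using vperm_torus_id[OF _ assms] by (auto simp: wall_def)
  show "vperm (Hilbert_Choice.inv \<pi>) ` wall s t \<subseteq> wall (\<pi> s) (\<pi> t)"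
    using vperm_torus_id[OF _ inv] assms by (auto simp: wall_def permutes_inverses)
qed

lemma card_torus:
  "card (torus id) = (q - 1) ^ 2" "finite (torus id)"
  "card (torus swap12) = q ^ 2 - 1" "finite (torus swap12)"
  "card (torus cyc) = q ^ 2 + q + 1" "finite (torus cyc)"
  using bij_betw_same_card[OF torus_id_bij] bij_betw_finite[OF torus_id_bij]
    bij_betw_same_card[OF torus_swap12_bij] bij_betw_finite[OF torus_swap12_bij]
    bij_betw_same_card[OF torus_cyc_bij] bij_betw_finite[OF torus_cyc_bij]
    card_unit_roots
  by (simp_all add: card_cartesian_product power2_eq_square)

lemma card_wall_12: "card (wall 1 2) = q - 1" "finite (wall 1 2)"
  using bij_betw_same_card[OF wall_12_bij] bij_betw_finite[OF wall_12_bij] card_unit_roots by simp_all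

lemma card_wall: "card (wall 1 2) = q - 1" "card (wall 1 3) = q - 1" "card (wall 2 3) = q - 1"
proof -
  show "card (wall 1 2) = q - 1"
    by (rule card_wall_12)
  have "cyc 2 = 3" "cyc 1 = 2"
    by simp_all
  then show "card (wall 2 3) = q - 1"
    using bij_betw_same_card[OF wall_vperm[OF permutes_cyc, of 1 2]] card_wall_12 by simp
  have sym: "wall 3 1 = wall 1 3"
    by (auto simp: wall_def)
  show "card (wall 1 3) = q - 1"
    using bij_betw_same_card[OF wall_vperm[OF permutes_cyc, of 2 3]] \<open>card (wall 2 3) = q - 1\<close>
    by (simp add: sym)
qed

lemma finite_wall: "finite (wall s t)"
  using card_torus(2) by (rule rev_finite_subset) (auto simp: wall_def)

lemma finite_center: "finite center"
  using card_torus(2) by (rule rev_finite_subset) (auto simp: center_def)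

section \<open>Counting tuples of torus elements\<close>

lemma lists_over_Int: "lists_over A r \<inter> lists_over B r = lists_over (A \<inter> B) r"
  by auto

lemma card_lists_over_Diff:
  assumes "A \<subseteq> B" "finite B"
  shows "real (card (lists_over B r - lists_over A r)) = real (card B) ^ r - real (card A) ^ r"
proof -
  have fin: "finite A"
    using assms by (rule finite_subset)
  have "card (lists_over B r - lists_over A r) = card B ^ r - card A ^ r"
    using assms fin
    by (subst card_Diff_subset) (auto simp: card_lists_length_eq finite_lists_length_eq)
  moreover have "card A ^ r \<le> card B ^ r"
    using assms by (intro power_mono card_mono) auto
  ultimately show ?thesis
    by (simp add: of_nat_diff)
qed

text \<open>In this torus one coincidence of entries spreads to all three under Frobenius, so every
  noncentral element has distinct entries.\<close>

lemma separating_lists_cyc: "separating_lists cyc r = lists_over (torus cyc) r - lists_over center r"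
proof -
  have "center \<subseteq> torus cyc"
    by (auto simp: center_def torus_def twisted_vec_def forall_3)
  moreover have "separating ds \<longleftrightarrow> \<not> set ds \<subseteq> center" if ds: "set ds \<subseteq> torus cyc" for ds
  proof
    have "(1 :: 3) \<noteq> 2"
      by simp
    then show "separating ds \<Longrightarrow> \<not> set ds \<subseteq> center"
      unfolding separating_def center_iff subset_iff by blast
    assume "\<not> set ds \<subseteq> center"
    then obtain d where d: "d \<in> set ds" "d \<notin> center"
      by blast
    have tw: "frob (d $ 1) = d $ 2" "frob (d $ 2) = d $ 3" "frob (d $ 3) = d $ 1"
      using d(1) ds by (auto simp: torus_def twisted_vec_def)
    have "d $ 1 \<noteq> d $ 2"
    proof
      assume eq: "d $ 1 = d $ 2"
      with tw have "d $ 2 = d $ 3"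
        by simp
      with eq have "d \<in> center"
        using d(1) ds tw by (auto simp: center_def torus_def twisted_vec_def forall_3)
      with d(2) show False
        by simp
    qed
    with tw have "d $ 1 \<noteq> d $ 2 \<and> d $ 1 \<noteq> d $ 3 \<and> d $ 2 \<noteq> d $ 3"
      by (metis frob_eq_iff)
    then have "\<forall>i j. i \<noteq> j \<longrightarrow> d $ i \<noteq> d $ j"
      unfolding forall_3 by auto
    with d(1) show "separating ds"
      unfolding separating_def by blast
  qed
  ultimately show ?thesis
    unfolding separating_lists_def by auto
qed

text \<open>If the first two entries differ, Frobenius moves both and so the fixed third entry
  differs from them; if they agree, all entries are rational and the element lies on
  \<open>wall 1 2\<close>.\<close>

lemma separating_lists_swap12:
  "separating_lists swap12 r = lists_over (torus swap12) r - lists_over (wall 1 2) r"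
proof -
  have "separating ds \<longleftrightarrow> \<not> set ds \<subseteq> wall 1 2" if ds: "set ds \<subseteq> torus swap12" for ds
  proof
    have "(1 :: 3) \<noteq> 2"
      by simp
    then show "separating ds \<Longrightarrow> \<not> set ds \<subseteq> wall 1 2"
      unfolding separating_def wall_def subset_iff by blast
    assume "\<not> set ds \<subseteq> wall 1 2"
    then obtain d where d: "d \<in> set ds" "d \<notin> wall 1 2"
      by blast
    have tw: "frob (d $ 1) = d $ 2" "frob (d $ 2) = d $ 1" "frob (d $ 3) = d $ 3"
      using d(1) ds by (auto simp: torus_def twisted_vec_def)
    have "d $ 1 \<noteq> d $ 2"
      using d ds tw by (auto simp: wall_def torus_def twisted_vec_def forall_3)
    with tw have "d $ 1 \<noteq> d $ 2 \<and> d $ 1 \<noteq> d $ 3 \<and> d $ 2 \<noteq> d $ 3"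
      by metis
    then have "\<forall>i j. i \<noteq> j \<longrightarrow> d $ i \<noteq> d $ j"
      unfolding forall_3 by auto
    with d(1) show "separating ds"
      unfolding separating_def by blast
  qed
  then show ?thesis
    unfolding separating_lists_def by auto
qed

lemma wall_12_subset: "wall 1 2 \<subseteq> torus swap12"
  by (auto simp: wall_def torus_def twisted_vec_def forall_3)

lemma center_subset: "center \<subseteq> torus cyc" "center \<subseteq> wall 1 2"
  by (auto simp: center_def wall_def torus_def twisted_vec_def forall_3)

text \<open>Inclusion-exclusion over the three walls. Any two of them already meet in the centre, so
  the last coefficient is 3 - 1 = 2: three pairwise intersections minus the triple one.\<close>

lemma card_separating_lists_id:
  "real (card (separating_lists id r)) =
    (real q - 1) ^ (2 * r) - 3 * (real q - 1) ^ r + 2 * real (card center) ^ r"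
proof -
  let ?T = "lists_over (torus id) r" and ?A = "lists_over (wall 1 2) r"
    and ?B = "lists_over (wall 1 3) r" and ?C = "lists_over (wall 2 3) r"
  have fin: "finite ?T" "finite ?A" "finite ?B" "finite ?C"
    by (simp_all add: finite_lists_length_eq finite_wall card_torus)
  have "separating_lists id r = ?T - (?A \<union> ?B \<union> ?C)"
    unfolding separating_lists_def separating_def forall_3 wall_def
    by (auto simp: subset_iff) metis+
  moreover have "?A \<union> ?B \<union> ?C \<subseteq> ?T"
    by (auto simp: wall_def)
  ultimately have "card (separating_lists id r) + card (?A \<union> ?B \<union> ?C) = card ?T"
    using fin by (simp add: card_Diff_subset card_mono)
  moreover have "wall 1 2 \<inter> wall 1 3 = center" "(wall 1 2 \<union> wall 1 3) \<inter> wall 2 3 = center"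
    "wall 1 2 \<inter> wall 2 3 = center" "wall 1 3 \<inter> wall 2 3 = center"
    by (auto simp: wall_def center_def)
  then have AB: "?A \<inter> ?B = lists_over center r" and ABC: "(?A \<union> ?B) \<inter> ?C = lists_over center r"
    by (simp_all add: lists_over_Int Int_Un_distrib2)
  have "card ?A + card ?B = card (?A \<union> ?B) + card (lists_over center r)"
    using card_Un_Int[OF fin(2,3)] AB by simp
  moreover have "card (?A \<union> ?B) + card ?C = card (?A \<union> ?B \<union> ?C) + card (lists_over center r)"
    using card_Un_Int[OF finite_UnI[OF fin(2,3)] fin(4)] ABC by simp
  moreover have "card ?T = (q - 1) ^ (2 * r)" "card ?A = (q - 1) ^ r" "card ?B = (q - 1) ^ r"
    "card ?C = (q - 1) ^ r" "card (lists_over center r) = card center ^ r"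
    by (simp_all add: card_lists_length_eq finite_wall finite_center card_torus card_wall power_mult)
  ultimately have "card (separating_lists id r) + 3 * (q - 1) ^ r
      = (q - 1) ^ (2 * r) + 2 * card center ^ r"
    by linarith
  from arg_cong[OF this, of real] show ?thesis
    using q_gt_1 by (simp add: of_nat_diff)
qed

section \<open>Rational cube roots of unity and the final formulas\<close>

lemma card_center_case_A:
  assumes "case_A p k"
  shows "card center = 3"
proof -
  have "[int q = 1] (mod 3)"
  proof (cases "[int p = 1] (mod 3)")
    case True
    then show ?thesis
      using cong_pow[of "int p" 1 3 k] by (simp add: q_def)
  next
    case False
    then have "[int p = - 1] (mod 3)" "even k"
      using assms by (auto simp: case_A_def)
    then show ?thesis
      using cong_pow[of "int p" "- 1" 3 k] by (simp add: q_def)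
  qed
  then have dvd: "3 dvd int q - 1"
    by (simp add: cong_iff_dvd_diff)
  then have "int 3 dvd int (q - 1)"
    using q_gt_1 by (simp add: of_nat_diff)
  then have "3 dvd q - 1"
    by (simp only: int_dvd_int_iff)
  then obtain m where m: "q - 1 = 3 * m"
    by blast
  have "x ^ (q - 1) = 1" if "x ^ 3 = 1" for x :: "'a alg_closure"
    unfolding m power_mult that by (rule power_one)
  then have "{x. x ^ 3 = 1 \<and> frob x = x} = unit_roots 3"
    by (auto simp: frob_fixed_iff)
  \<comment> \<open>Characteristic 3 is impossible: q - 1 is a multiple of 3, while \<open>q\<close>
    is 0 in the field.\<close>
  moreover have "of_nat 3 \<noteq> (0 :: 'a alg_closure)"
  proof
    assume "of_nat 3 = (0 :: 'a alg_closure)"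
    moreover have "of_nat q - of_nat 1 = (of_nat 3 * of_nat m :: 'a alg_closure)"
      using q_gt_1 by (metis m of_nat_diff of_nat_mult less_imp_le)
    ultimately show False
      by (simp add: of_nat_q)
  qed
  then have "card (unit_roots 3) = 3"
    by (rule card_roots_of_unity_alg_closed)
  ultimately show ?thesis
    using bij_betw_same_card[OF center_bij] by simp
qed

text \<open>Here \<open>q\<close> is 0 or 2 modulo 3. For a cube root of unity, being fixed by
  Frobenius therefore means x = 1 or x = x^2, and both give x = 1.\<close>

lemma card_center_case_B:
  assumes "case_B p k"
  shows "card center = 1"
proof -
  have "k \<noteq> 0"
    using q_gt_1 q_def by (cases k) auto
  have "[int q = 0] (mod 3) \<or> [int q = - 1] (mod 3)"
    using assms cong_pow[of "int p" 0 3 k] cong_pow[of "int p" "- 1" 3 k] \<open>k \<noteq> 0\<close>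
    by (auto simp: case_B_def q_def power_0_left)
  then have "int q mod 3 = 0 \<or> int q mod 3 = 2"
    by (auto simp: cong_def)
  then have "q mod 3 = 0 \<or> q mod 3 = 2"
    by presburger
  moreover have "x ^ q = x ^ (q mod 3)" if "x ^ 3 = 1" for x :: "'a alg_closure"
  proof -
    have "x ^ q = x ^ (3 * (q div 3) + q mod 3)"
      by simp
    also have "\<dots> = x ^ (q mod 3)"
      using that by (simp only: power_add power_mult power_one mult_1_left)
    finally show ?thesis .
  qed
  ultimately have "x = 1" if "x ^ 3 = 1" "frob x = x" for x
    using that by (auto simp: frob_def power2_eq_square power3_eq_cube)
  then have "{x. x ^ 3 = 1 \<and> frob x = x} = {1}"
    by auto
  then show ?thesis
    using bij_betw_same_card[OF center_bij] by simp
qed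

text \<open>Both cases at once in terms of \<open>c\<close>. In the reducible stratum c^r / 3 arises
  as 2c^r / 6.\<close>

lemma num_closed_orbits_strata:
  fixes r :: nat
  defines "c \<equiv> real (card center)"
  shows
    "real (num_closed_orbits r (central_tuple :: ('a alg_closure ^ 3 ^ 3) list \<Rightarrow> bool)) = c ^ r"
    "real (num_closed_orbits r (repeating_tuple :: ('a alg_closure ^ 3 ^ 3) list \<Rightarrow> bool))
      = (real q - 1) ^ r - c ^ r"
    "real (num_closed_orbits r (reducible_tuple :: ('a alg_closure ^ 3 ^ 3) list \<Rightarrow> bool))
      = (real q - 1) ^ (2 * r) / 6 - (real q - 1) ^ r / 2 + c ^ r / 3"
    "real (num_closed_orbits r (irreducible_tuple :: ('a alg_closure ^ 3 ^ 3) list \<Rightarrow> bool))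
      = ((real q)\<^sup>2 + real q + 1) ^ r / 3 - c ^ r / 3"
    "real (num_closed_orbits r (partially_reducible_tuple :: ('a alg_closure ^ 3 ^ 3) list \<Rightarrow> bool))
      = ((real q)\<^sup>2 - 1) ^ r / 2 - (real q - 1) ^ r / 2"
proof -
  have q2: "q ^ 2 \<ge> 1"
    using q_gt_1 by (simp add: Suc_leI)
  show "real (num_closed_orbits r (central_tuple :: ('a alg_closure ^ 3 ^ 3) list \<Rightarrow> bool)) = c ^ r"
    unfolding card_central[OF finite_center, symmetric]
    by (simp add: card_lists_length_eq finite_center c_def)
  show "real (num_closed_orbits r (repeating_tuple :: ('a alg_closure ^ 3 ^ 3) list \<Rightarrow> bool))
      = (real q - 1) ^ r - c ^ r"
    unfolding card_repeating[OF finite_wall, symmetric]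
      card_lists_over_Diff[OF center_subset(2) finite_wall] c_def
    using q_gt_1 by (simp add: card_wall of_nat_diff)
  show "real (num_closed_orbits r (reducible_tuple :: ('a alg_closure ^ 3 ^ 3) list \<Rightarrow> bool))
      = (real q - 1) ^ (2 * r) / 6 - (real q - 1) ^ r / 2 + c ^ r / 3"
    using arg_cong[OF card_reducible[OF card_torus(2), of r], of real] card_separating_lists_id[of r]
    by (simp add: c_def)
  have "3 * real (num_closed_orbits r (irreducible_tuple :: ('a alg_closure ^ 3 ^ 3) list \<Rightarrow> bool))
      = ((real q)\<^sup>2 + real q + 1) ^ r - c ^ r"
    using arg_cong[OF card_irreducible[OF card_torus(6), of r], of real]
    unfolding separating_lists_cyc card_lists_over_Diff[OF center_subset(1) card_torus(6)]
    by (simp add: card_torus c_def algebra_simps)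
  then show "real (num_closed_orbits r (irreducible_tuple :: ('a alg_closure ^ 3 ^ 3) list \<Rightarrow> bool))
      = ((real q)\<^sup>2 + real q + 1) ^ r / 3 - c ^ r / 3"
    by simp
  have "2 * real (num_closed_orbits r (partially_reducible_tuple :: ('a alg_closure ^ 3 ^ 3) list \<Rightarrow> bool))
      = ((real q)\<^sup>2 - 1) ^ r - (real q - 1) ^ r"
    using arg_cong[OF card_partially_reducible[OF card_torus(4), of r], of real]
    unfolding separating_lists_swap12 card_lists_over_Diff[OF wall_12_subset card_torus(4)]
    using q_gt_1 q2 by (simp add: card_torus card_wall of_nat_diff)
  then show "real (num_closed_orbits r (partially_reducible_tuple :: ('a alg_closure ^ 3 ^ 3) list \<Rightarrow> bool))
      = ((real q)\<^sup>2 - 1) ^ r / 2 - (real q - 1) ^ r / 2"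
    by simp
qed

end
theorem theorem20:
  fixes p k q r :: nat
  assumes "r \<ge> 1" and "Factorial_Ring.prime p" and "q = p ^ k" and "CARD('a::{field,finite}) = q"
  shows
    "(case_A p k \<longrightarrow>
        real (num_closed_orbits r (central_tuple :: ('a alg_closure ^ 3 ^ 3) list \<Rightarrow> bool))
          = 3 ^ r) \<and>
     (case_B p k \<longrightarrow>
        real (num_closed_orbits r (central_tuple :: ('a alg_closure ^ 3 ^ 3) list \<Rightarrow> bool))
          = 1) \<and>
     (case_A p k \<longrightarrow>
        real (num_closed_orbits r (repeating_tuple :: ('a alg_closure ^ 3 ^ 3) list \<Rightarrow> bool))
          = (real q - 1) ^ r - 3 ^ r) \<and>
     (case_B p k \<longrightarrow>
        real (num_closed_orbits r (repeating_tuple :: ('a alg_closure ^ 3 ^ 3) list \<Rightarrow> bool))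
          = (real q - 1) ^ r - 1) \<and>
     (case_A p k \<longrightarrow>
        real (num_closed_orbits r (reducible_tuple :: ('a alg_closure ^ 3 ^ 3) list \<Rightarrow> bool))
          = (real q - 1) ^ (2 * r) / 6 - (real q - 1) ^ r / 2 + 3 ^ (r - 1)) \<and>
     (case_B p k \<longrightarrow>
        real (num_closed_orbits r (reducible_tuple :: ('a alg_closure ^ 3 ^ 3) list \<Rightarrow> bool))
          = (real q - 1) ^ (2 * r) / 6 - (real q - 1) ^ r / 2 + 1 / 3) \<and>
     (case_A p k \<longrightarrow>
        real (num_closed_orbits r (irreducible_tuple :: ('a alg_closure ^ 3 ^ 3) list \<Rightarrow> bool))
          = ((real q)\<^sup>2 + real q + 1) ^ r / 3 - 3 ^ (r - 1)) \<and>
     (case_B p k \<longrightarrow>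
        real (num_closed_orbits r (irreducible_tuple :: ('a alg_closure ^ 3 ^ 3) list \<Rightarrow> bool))
          = ((real q)\<^sup>2 + real q + 1) ^ r / 3 - 1 / 3) \<and>
     (case_A p k \<or> case_B p k \<longrightarrow>
        real (num_closed_orbits r
            (partially_reducible_tuple :: ('a alg_closure ^ 3 ^ 3) list \<Rightarrow> bool))
          = ((real q)\<^sup>2 - 1) ^ r / 2 - (real q - 1) ^ r / 2)"
proof -
  interpret finite_field_closure "TYPE('a)" p k q
    using assms by unfold_locales auto
  \<comment> \<open>This uses r \<ge> 1, since subtraction on \<open>nat\<close> is
    truncated.\<close>
  have "(3 :: real) ^ r / 3 = 3 ^ (r - 1)"
    using assms(1) by (cases r) auto
  then show ?thesis
    using num_closed_orbits_strata[of r] card_center_case_A card_center_case_B by simp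
qed

end
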